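(* Let $\mathbf{X}=\{\mathbf{x}^1,\ldots,\mathbf{x}^s\}$ be a linearly independent set of vectors in $\mathbb{R}^s$, let $\{\tilde{\mathbf{x}}^1,\ldots,\tilde{\mathbf{x}}^s\}$ be its dual basis, let $\mathbf{e}^k$ be the $k$th canonical vector in $\mathbb{R}^s$, and let $\boldsymbol{\alpha}=(\alpha_1,\ldots,\alpha_s)\in\mathbb{R}^s$ have positive components. If $\boldsymbol{\alpha}-\mathbf{e}^k$ has positive components for every $k=1,\ldots,s$ and $|\boldsymbol{\alpha}|:=\alpha_1+\cdots+\alpha_s\neq s$, then $$C_{\boldsymbol{\alpha}}(\mathbf{x}\mid\mathbf{X})=\frac{1}{|\boldsymbol{\alpha}|-s}\sum_{k=1}^s\langle\mathbf{x},\tilde{\mathbf{x}}^k\rangle\,C_{\boldsymbol{\alpha}-\mathbf{e}^k}(\mathbf{x}\mid\mathbf{X}).$$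
   Context: Fourier transform convention: $\hat f(\boldsymbol{\omega})=\int f(\mathbf{x})e^{-i\langle\boldsymbol{\omega},\mathbf{x}\rangle}d\mathbf{x}$, extended to tempered distributions. Fractional cone spline: for linearly independent $\mathbf{x}^1,\ldots,\mathbf{x}^s\in\mathbb{R}^s$ and $\alpha_1,\ldots,\alpha_s>0$, $C_{\boldsymbol{\alpha}}(\cdot\mid\mathbf{X})$ is the tempered distribution on $\mathbb{R}^s$ with Fourier transform $$\widehat{C_{\boldsymbol{\alpha}}}(\boldsymbol{\omega}\mid\mathbf{X})=\prod_{k=1}^s\left(\frac{1}{i\langle\boldsymbol{\omega},\mathbf{x}^k\rangle}+\sigma_k\pi\,\delta(\langle\boldsymbol{\omega},\mathbf{x}^k\rangle)\right)^{\alpha_k},\qquad\sigma_k=\begin{cases}1,&\alpha_k\in\{1,2,3,\ldots\}\\0,&\text{otherwise.}\end{cases}$$ The product is the direct (tensor) product of one-variable distributions in the variables $\langle\boldsymbol{\omega},\mathbf{x}^k\rangle$. For integer $\alpha_k$ the factor is the Fourier transform of the $\alpha_k$-fold convolution of the Heaviside function with itself; for non-integer $\alpha_k$ it is the usual regularization (by analytic continuation in the exponent) of $(i\omega)^{-\alpha_k}$, principal branch. Equivalently, $\widehat{C_{\boldsymbol{\alpha}}}$ is the limit in the space of tempered distributions, as $\varepsilon\to0^+$, of $\prod_{k}(\varepsilon+i\langle\boldsymbol{\omega},\mathbf{x}^k\rangle)^{-\alpha_k}$ (principal branch). The dual basis is determined by $\langle\mathbf{x}^j,\tilde{\mathbf{x}}^k\rangle=\delta_{jk}$.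 The asserted equality is between tempered distributions, equivalently almost everywhere between the locally integrable functions representing them. *)

theory Defs
  imports "HOL-Analysis.Analysis"
begin

section \<open>Schwartz functions\<close>

definition dir_deriv :: "'a::euclidean_space \<Rightarrow> ('a \<Rightarrow> complex) \<Rightarrow> 'a \<Rightarrow> complex" where
  "dir_deriv b f x = frechet_derivative f (at x) b"

definition iter_deriv :: "'a::euclidean_space list \<Rightarrow> ('a \<Rightarrow> complex) \<Rightarrow> 'a \<Rightarrow> complex" where
  "iter_deriv bs f = foldr dir_deriv bs f"

definition smooth :: "('a::euclidean_space \<Rightarrow> complex) \<Rightarrow> bool" where
  "smooth f \<longleftrightarrow> (\<forall>bs. set bs \<subseteq> Basis \<longrightarrow> (\<forall>x. iter_deriv bs f differentiable (at x)))"

definition schwartz :: "('a::euclidean_space \<Rightarrow> complex) \<Rightarrow> bool" where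
  "schwartz f \<longleftrightarrow> smooth f \<and>
     (\<forall>bs N. set bs \<subseteq> Basis \<longrightarrow> bounded (range (\<lambda>x. (1 + norm x) ^ N * norm (iter_deriv bs f x))))"

text \<open>An increasing sequence of seminorms that generates the topology of the Schwartz space.\<close>

definition schwartz_seminorm :: "nat \<Rightarrow> ('a::euclidean_space \<Rightarrow> complex) \<Rightarrow> real" where
  "schwartz_seminorm N f =
     (\<Sum>bs \<in> {bs. set bs \<subseteq> Basis \<and> length bs \<le> N}.
        SUP x. (1 + norm x) ^ N * norm (iter_deriv bs f x))"


section \<open>Tempered distributions\<close>

text \<open>
  A tempered distribution is a continuous linear functional on the Schwartz space. As HOL functions
  are total, it is extended by 0 to functions that are not Schwartz; two tempered distributions
  are then equal as HOL functions iff they agree on all Schwartz functions.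
\<close>

type_synonym 'a functional = "('a \<Rightarrow> complex) \<Rightarrow> complex"

definition tempered :: "'a::euclidean_space functional \<Rightarrow> bool" where
  "tempered T \<longleftrightarrow>
     (\<forall>\<phi>. \<not> schwartz \<phi> \<longrightarrow> T \<phi> = 0) \<and>
     (\<forall>\<phi> \<psi>. schwartz \<phi> \<longrightarrow> schwartz \<psi> \<longrightarrow> T (\<lambda>x. \<phi> x + \<psi> x) = T \<phi> + T \<psi>) \<and>
     (\<forall>c \<phi>. schwartz \<phi> \<longrightarrow> T (\<lambda>x. c * \<phi> x) = c * T \<phi>) \<and>
     (\<exists>N C. \<forall>\<phi>. schwartz \<phi> \<longrightarrow> norm (T \<phi>) \<le> C * schwartz_seminorm N \<phi>)"

definition dist_of_fun :: "('a::euclidean_space \<Rightarrow> complex) \<Rightarrow> 'a functional" where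
  "dist_of_fun f \<phi> = (if schwartz \<phi> then (LINT x|lborel. f x * \<phi> x) else 0)"

definition dist_mult :: "('a::euclidean_space \<Rightarrow> real) \<Rightarrow> 'a functional \<Rightarrow> 'a functional" where
  "dist_mult p T \<phi> = (if schwartz \<phi> then T (\<lambda>x. complex_of_real (p x) * \<phi> x) else 0)"

definition fourier :: "('a::euclidean_space \<Rightarrow> complex) \<Rightarrow> 'a \<Rightarrow> complex" where
  "fourier f \<omega> = (LINT x|lborel. f x * exp (- (\<i> * complex_of_real (\<omega> \<bullet> x))))"

definition dist_fourier :: "'a::euclidean_space functional \<Rightarrow> 'a functional" where
  "dist_fourier T \<phi> = (if schwartz \<phi> then T (fourier \<phi>) else 0)"

definition dist_tendsto ::
  "('b \<Rightarrow> 'a::euclidean_space functional) \<Rightarrow> 'a functional \<Rightarrow> 'b filter \<Rightarrow> bool" where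
  "dist_tendsto S T F \<longleftrightarrow> (\<forall>\<phi>. schwartz \<phi> \<longrightarrow> ((\<lambda>\<epsilon>. S \<epsilon> \<phi>) \<longlongrightarrow> T \<phi>) F)"


section \<open>Fractional cone splines\<close>

definition cone_symbol ::
  "real ^ 'n \<Rightarrow> ('n::finite \<Rightarrow> real ^ 'n) \<Rightarrow> real \<Rightarrow> real ^ 'n \<Rightarrow> complex" where
  "cone_symbol \<alpha> X \<epsilon> \<omega> =
     (\<Prod>k\<in>UNIV. (complex_of_real \<epsilon> + \<i> * complex_of_real (\<omega> \<bullet> X k))
                powr complex_of_real (- (\<alpha> $ k)))"

text \<open>
  The cone spline is the tempered distribution whose Fourier transform is the direct product over
  \<open>k\<close> of the one-variable distributions \<open>(1/(i t) + \<sigma>\<^sub>k \<pi> \<delta>(t))\<close> to the power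
  \<open>\<alpha>\<^sub>k\<close> in the variables \<open>t = \<omega> \<bullet> X k\<close>. That
  product is read as the limit, in the space of tempered distributions, of
  \<open>cone_symbol \<alpha> X \<epsilon>\<close> as \<open>\<epsilon>\<close> decreases to 0. In particular the
  delta terms for integer exponents come out of the limit: \<open>1/(\<epsilon> + i t)\<close> tends to
  \<open>1/(i t) + \<pi> \<delta>(t)\<close>, with the principal value for \<open>1/(i t)\<close>.
\<close>

definition cone_spline ::
  "real ^ 'n \<Rightarrow> ('n::finite \<Rightarrow> real ^ 'n) \<Rightarrow> (real ^ 'n) functional" where
  "cone_spline \<alpha> X =
     (THE C. tempered C \<and>
        dist_tendsto (\<lambda>\<epsilon>. dist_of_fun (cone_symbol \<alpha> X \<epsilon>)) (dist_fourier C) (at_right 0))"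

end

theory Submission
  imports Defs "HOL-Probability.Sinc_Integral" "HOL-Real_Asymp.Real_Asymp"
begin

text \<open>
  The idea is that the cone spline is an ordinary function. In the dual coordinates
  \<open>t k = x \<bullet> Xd k\<close> it is a constant multiple of the product of the truncated powers
  \<open>(t k)\<^sub>+\<close> to the \<open>\<alpha> k - 1\<close>, divided by \<open>\<Gamma>(\<alpha> k)\<close>, and the constant depends only on \<open>X\<close>.
  Multiplying the spline for \<open>\<alpha> - axis k 1\<close> by \<open>t k\<close> restores the exponent in the \<open>k\<close>-th factor,
  and \<open>\<Gamma>(a) = (a - 1) \<Gamma>(a - 1)\<close> turns this into \<open>\<alpha> k - 1\<close> times the spline for \<open>\<alpha>\<close>. Summing
  over \<open>k\<close> gives the factor \<open>|\<alpha>| - s\<close>, where \<open>s\<close> is the dimension.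

  The cone spline is given only through its Fourier transform, as the limit of the symbols
  \<open>\<Prod>k. (\<epsilon> + \<i> (\<omega> \<bullet> X k)) powr (- \<alpha> k)\<close>. Identifying it with the function above
  (\<open>cone_spline_eq_cone_density\<close>) has two halves. For existence, the symbol is the Fourier transform
  of the product density damped by \<open>exp (- \<epsilon> t k)\<close> in each coordinate. This rests on the
  one-variable formula \<open>gamma_transform_eq\<close> and on the linear change of variables in
  \<open>fourier_dual_basis_product\<close>. Moving the transform onto the test function makes the limit an instance
  of dominated convergence. For uniqueness, a tempered distribution must be determined by its Fourier
  transform, which holds since every Schwartz function is the transform of a Schwartz function
  (\<open>fourier_surj_schwartz\<close>, a consequence of the inversion theorem \<open>fourier_fourier\<close>).
\<close>

section \<open>Linear changes of variables and product integrals\<close>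

lemma nn_integral_lborel_translate:
  fixes f :: "'a::euclidean_space \<Rightarrow> ennreal"
  assumes [measurable]: "f \<in> borel_measurable borel"
  shows "(\<integral>\<^sup>+x. f (x + a) \<partial>lborel) = (\<integral>\<^sup>+x. f x \<partial>lborel)"
proof -
  have "(\<integral>\<^sup>+x. f x \<partial>lborel) = (\<integral>\<^sup>+x. f x \<partial>distr lborel borel ((+) a))"
    by (simp add: lborel_distr_plus)
  also have "\<dots> = (\<integral>\<^sup>+x. f (x + a) \<partial>lborel)"
    by (subst nn_integral_distr) (auto simp: add.commute)
  finally show ?thesis by simp
qed

lemma nn_integral_lborel_reflect:
  fixes f :: "'a::euclidean_space \<Rightarrow> ennreal"
  assumes [measurable]: "f \<in> borel_measurable borel"
  shows "(\<integral>\<^sup>+x. f (a - x) \<partial>lborel) = (\<integral>\<^sup>+x. f x \<partial>lborel)"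
proof -
  have "(lborel :: 'a measure) = distr lborel borel (\<lambda>x. a - x)"
    using lborel_affine[of "-1" a] by (simp add: density_1)
  then have "(\<integral>\<^sup>+x. f x \<partial>lborel) = (\<integral>\<^sup>+x. f x \<partial>distr lborel borel (\<lambda>x. a - x))"
    by simp
  also have "\<dots> = (\<integral>\<^sup>+x. f (a - x) \<partial>lborel)"
    by (simp add: nn_integral_distr)
  finally show ?thesis by simp
qed

text \<open>
  A linear bijection \<open>T\<close> transports Lebesgue measure to a translation invariant measure, and any two
  such measures are proportional. The identity expresses the proportionality symmetrically in
  \<open>f\<close> and \<open>g\<close>. It follows from Tonelli's theorem applied to \<open>f (T s) * g y\<close>: first
  \<open>y\<close> is shifted by \<open>T s\<close>, then \<open>s\<close> is shifted by the preimage of \<open>- y\<close>, and finally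
  \<open>y\<close> is reflected.
\<close>

lemma nn_integral_linear_cross:
  fixes T :: "'a::euclidean_space \<Rightarrow> 'a" and f g :: "'a \<Rightarrow> ennreal"
  assumes T: "linear T" and S: "\<And>x. T (S x) = x"
  assumes [measurable]: "f \<in> borel_measurable borel" "g \<in> borel_measurable borel"
  shows "(\<integral>\<^sup>+s. f (T s) \<partial>lborel) * (\<integral>\<^sup>+y. g y \<partial>lborel) =
         (\<integral>\<^sup>+s. g (T s) \<partial>lborel) * (\<integral>\<^sup>+y. f y \<partial>lborel)"
proof -
  have [measurable]: "T \<in> borel_measurable borel"
    using T by (intro borel_measurable_continuous_onI linear_continuous_on) (simp add: linear_conv_bounded_linear)
  have "(\<integral>\<^sup>+s. f (T s) \<partial>lborel) * (\<integral>\<^sup>+y. g y \<partial>lborel) =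
      (\<integral>\<^sup>+s. \<integral>\<^sup>+y. f (T s) * g (y + T s) \<partial>lborel \<partial>lborel)"
    by (simp add: nn_integral_cmult nn_integral_multc nn_integral_lborel_translate)
  also have "\<dots> = (\<integral>\<^sup>+y. \<integral>\<^sup>+s. f (T s) * g (y + T s) \<partial>lborel \<partial>lborel)"
    by (rule lborel_pair.Fubini') simp
  also have "\<dots> = (\<integral>\<^sup>+y. \<integral>\<^sup>+s. f (T (s + S (-y))) * g (y + T (s + S (-y))) \<partial>lborel \<partial>lborel)"
    by (subst nn_integral_lborel_translate[where f="\<lambda>s. f (T s) * g (_ + T s)"]) auto
  also have "\<dots> = (\<integral>\<^sup>+y. \<integral>\<^sup>+s. f (T s - y) * g (T s) \<partial>lborel \<partial>lborel)"
    by (simp add: linear_add[OF T] S)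
  also have "\<dots> = (\<integral>\<^sup>+s. \<integral>\<^sup>+y. f (T s - y) * g (T s) \<partial>lborel \<partial>lborel)"
    by (rule lborel_pair.Fubini') simp
  also have "\<dots> = (\<integral>\<^sup>+s. g (T s) \<partial>lborel) * (\<integral>\<^sup>+y. f y \<partial>lborel)"
    by (simp add: nn_integral_multc nn_integral_lborel_reflect mult.commute[of "integral\<^sup>N lborel f"])
  finally show ?thesis .
qed

lemma emeasure_lborel_open_nonzero:
  fixes U :: "'a::euclidean_space set"
  assumes "open U" "U \<noteq> {}"
  shows "emeasure lborel U \<noteq> 0"
proof
  assume "emeasure lborel U = 0"
  with assms have "U \<in> null_sets lborel" by auto
  then have "negligible U" by (simp add: negligible_iff_null_sets null_sets_completionI)
  with assms open_not_negligible show False by blast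
qed

text \<open>
  Testing the symmetric identity with \<open>g\<close> the indicator of the unit ball gives the constant
  \<open>c\<close>, which is the inverse modulus of the determinant of \<open>T\<close>. It is finite and positive because
  the preimage of the ball is bounded and contains a neighbourhood of 0.
\<close>

lemma lborel_linear_image:
  fixes T :: "'a::euclidean_space \<Rightarrow> 'a"
  assumes T: "linear T" and TS: "\<And>x. T (S x) = x"
  shows "\<exists>c>0. distr lborel borel T = density lborel (\<lambda>_. ennreal c)"
proof -
  have bl: "bounded_linear T" using T by (simp add: linear_conv_bounded_linear)
  have cont: "continuous_on A T" for A
    using bl by (rule linear_continuous_on)
  have Tm[measurable]: "T \<in> borel_measurable borel"
    by (intro borel_measurable_continuous_onI cont)
  define B where "B = (cball 0 1 :: 'a set)"
  have Bm[measurable]: "B \<in> sets borel" by (simp add: B_def)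
  have "surj T" using TS by (metis surjI)
  then have "inj T" using linear_surjective_imp_injective[OF T] by blast
  define A where "A = T -` B"
  have [measurable]: "A \<in> sets borel"
    unfolding A_def by (rule measurable_sets_borel[OF Tm Bm])
  have "bounded A"
  proof -
    obtain e where e: "e > 0" "\<And>x. norm x * e \<le> norm (T x)"
      using linear_inj_bounded_below_pos[OF T \<open>inj T\<close>] by (auto simp: mult.commute)
    have "norm x \<le> 1 / e" if "x \<in> A" for x
      using e(2)[of x] that e(1) by (auto simp: A_def B_def field_simps)
    then show ?thesis by (auto simp: bounded_iff)
  qed
  then have fin: "emeasure lborel A < \<infinity>" by (rule emeasure_bounded_finite)
  have "0 \<in> T -` ball 0 1" using linear_0[OF T] by simp
  moreover have "open (T -` ball 0 1)"
    using cont by (intro open_vimage) auto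
  ultimately have pos0: "emeasure lborel (T -` ball 0 1) \<noteq> 0"
    using emeasure_lborel_open_nonzero[of "T -` ball 0 1"] by blast
  have pos: "emeasure lborel A \<noteq> 0"
  proof
    assume "emeasure lborel A = 0"
    moreover have "emeasure lborel (T -` ball 0 1) \<le> emeasure lborel A"
    proof (rule emeasure_mono)
      show "T -` ball 0 1 \<subseteq> A" by (auto simp: A_def B_def)
    qed simp
    ultimately show False using pos0 by simp
  qed
  have Bfin: "emeasure lborel B < \<infinity>" unfolding B_def by (intro emeasure_bounded_finite bounded_cball)
  have Bpos: "emeasure lborel B \<noteq> 0"
  proof
    assume "emeasure lborel B = 0"
    moreover have "emeasure lborel (ball (0::'a) 1) \<le> emeasure lborel B"
      by (rule emeasure_mono) (auto simp: B_def)
    ultimately show False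
      using emeasure_lborel_open_nonzero[of "ball (0::'a) 1"] by auto
  qed
  define c where "c = measure lborel A / measure lborel B"
  have eA: "emeasure lborel A = ennreal (measure lborel A)"
    using fin by (intro emeasure_eq_ennreal_measure) auto
  have eB: "emeasure lborel B = ennreal (measure lborel B)"
    using Bfin by (intro emeasure_eq_ennreal_measure) auto
  have mA: "measure lborel A > 0" using pos eA by (auto simp: zero_less_measure_iff)
  have mB: "measure lborel B > 0" using Bpos eB by (auto simp: zero_less_measure_iff)
  have "c > 0" using mA mB by (simp add: c_def)
  moreover have "distr lborel borel T = density lborel (\<lambda>_. ennreal c)"
  proof (rule measure_eqI)
    fix E assume "E \<in> sets (distr lborel borel T)"
    then have Em[measurable]: "E \<in> sets borel" by simp
    have [measurable]: "T -` E \<in> sets borel"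
      by (rule measurable_sets_borel[OF Tm Em])
    have "emeasure lborel (T -` E) * emeasure lborel B = emeasure lborel A * emeasure lborel E"
    proof -
      have "(\<integral>\<^sup>+s. indicator E (T s) \<partial>lborel) = (\<integral>\<^sup>+s. indicator (T -` E) s \<partial>lborel)"
        "(\<integral>\<^sup>+s. indicator B (T s) \<partial>lborel) = (\<integral>\<^sup>+s. indicator A s \<partial>lborel)"
        by (simp_all add: indicator_def A_def)
      then show ?thesis
        using nn_integral_linear_cross[OF T TS, of "indicator E" "indicator B"] by simp
    qed
    then have "emeasure lborel (T -` E) * emeasure lborel B / emeasure lborel B = emeasure lborel A * emeasure lborel E / emeasure lborel B"
      by simp
    then have "emeasure lborel (T -` E) = emeasure lborel A * emeasure lborel E / emeasure lborel B"
      using Bfin Bpos by (subst (asm) ennreal_mult_divide_eq) auto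
    also have "\<dots> = ennreal c * emeasure lborel E"
      using mA mB by (simp add: eA eB c_def divide_ennreal[symmetric] ennreal_times_divide mult.commute
        ennreal_divide_times)
    finally show "emeasure (distr lborel borel T) E = emeasure (density lborel (\<lambda>_. ennreal c)) E"
      by (simp add: emeasure_distr emeasure_density nn_integral_cmult)
  qed simp
  ultimately show ?thesis by blast
qed

lemma lborel_prod_Basis:
  fixes f :: "'a::euclidean_space \<Rightarrow> real \<Rightarrow> 'b::{real_normed_field,banach,second_countable_topology}"
  assumes int: "\<And>b. b \<in> Basis \<Longrightarrow> integrable lborel (f b)"
  shows "integrable lborel (\<lambda>x::'a. \<Prod>b\<in>Basis. f b (x \<bullet> b))"
    and "(LINT x|lborel. (\<Prod>b\<in>Basis. f b (x \<bullet> b))) = (\<Prod>b\<in>Basis. LINT t|lborel. f b t)"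
proof -
  interpret product_sigma_finite "\<lambda>b::'a. lborel :: real measure"
    by standard
  have [measurable]: "f b \<in> borel_measurable borel" if "b \<in> Basis" for b
    using borel_measurable_integrable[OF int[OF that]] by simp
  let ?P = "\<Pi>\<^sub>M b\<in>(Basis::'a set). (lborel :: real measure)"
  let ?h = "\<lambda>f. \<Sum>b\<in>(Basis::'a set). f b *\<^sub>R b"
  have comp: "(\<Prod>b\<in>Basis. f b (?h x \<bullet> b)) = (\<Prod>b\<in>Basis. f b (x b))" for x :: "'a \<Rightarrow> real"
    by (intro prod.cong refl) simp
  have m: "(\<lambda>x::'a. \<Prod>b\<in>Basis. f b (x \<bullet> b)) \<in> borel_measurable borel"
    by measurable
  have h: "?h \<in> ?P \<rightarrow>\<^sub>M borel" by measurable
  show "integrable lborel (\<lambda>x::'a. \<Prod>b\<in>Basis. f b (x \<bullet> b))"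
    by (subst lborel_eq, subst integrable_distr_eq[OF h m], subst comp, rule product_integrable_prod)
       (auto intro: int)
  show "(LINT x|lborel. (\<Prod>b\<in>Basis. f b (x \<bullet> b))) = (\<Prod>b\<in>Basis. LINT t|lborel. f b t)"
    by (subst lborel_eq, subst integral_distr[OF h m], subst comp, rule product_integral_prod)
       (auto intro: int)
qed

lemma integrable_inverse_1_plus_square_lborel:
  "integrable lborel (\<lambda>t::real. 1 / (1 + t\<^sup>2))"
  using integrable_inverse_1_plus_square by (simp add: set_integrable_def inverse_eq_divide)

lemma integral_inverse_1_plus_square_lborel: "(LINT t|lborel. 1 / (1 + t\<^sup>2)) = pi"
  using LBINT_inverse_1_plus_square
  by (simp add: interval_lebesgue_integral_def set_lebesgue_integral_def inverse_eq_divide)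

text \<open>
  Each \<open>1 + (x \<bullet> b)\<^sup>2\<close> is at most \<open>(1 + norm x)\<^sup>2\<close>, so the product of the functions
  \<open>1 / (1 + (x \<bullet> b)\<^sup>2)\<close> is an integrable majorant.
\<close>

lemma integrable_polynomial_decay:
  "integrable lborel (\<lambda>x::'a::euclidean_space. 1 / (1 + norm x) ^ (2 * DIM('a)))"
proof (rule Bochner_Integration.integrable_bound)
  show "integrable lborel (\<lambda>x::'a. \<Prod>b\<in>Basis. 1 / (1 + (x \<bullet> b)\<^sup>2))"
    by (rule lborel_prod_Basis(1)[where f="\<lambda>b t. 1 / (1 + t\<^sup>2)"])
       (rule integrable_inverse_1_plus_square_lborel)
  show "AE x::'a in lborel. norm (1 / (1 + norm x) ^ (2 * DIM('a))) \<le> norm (\<Prod>b\<in>Basis. 1 / (1 + (x \<bullet> b)\<^sup>2))"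
  proof (rule AE_I2)
    fix x :: 'a
    have le: "1 + (x \<bullet> b)\<^sup>2 \<le> (1 + norm x)\<^sup>2" if "b \<in> Basis" for b
    proof -
      have "(x \<bullet> b)\<^sup>2 \<le> (norm x)\<^sup>2"
        using Basis_le_norm[OF that, of x] by (metis abs_norm_cancel abs_le_square_iff)
      also have "1 + (norm x)\<^sup>2 \<le> (1 + norm x)\<^sup>2"
        by (simp add: power2_eq_square algebra_simps)
      finally show ?thesis by simp
    qed
    have "1 / (1 + norm x) ^ (2 * DIM('a)) = (\<Prod>b\<in>(Basis::'a set). 1 / (1 + norm x)\<^sup>2)"
      by (simp add: power_mult power_one_over)
    also have "\<dots> \<le> (\<Prod>b\<in>(Basis::'a set). 1 / (1 + (x \<bullet> b)\<^sup>2))"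
      using le by (intro prod_mono) (auto intro!: divide_left_mono mult_pos_pos add_pos_nonneg zero_less_power simp: add_pos_nonneg)
    finally show "norm (1 / (1 + norm x) ^ (2 * DIM('a))) \<le> norm (\<Prod>b\<in>Basis. 1 / (1 + (x \<bullet> b)\<^sup>2))"
      by (simp add: prod_nonneg)
  qed
qed measurable

section \<open>The Fourier transform of integrable functions\<close>

lemma norm_exp_minus_i [simp]: "norm (exp (- (\<i> * complex_of_real t))) = 1"
  using norm_exp_i_times[of "-t"] by simp

lemma integrable_mult_character:
  fixes f :: "'a::euclidean_space \<Rightarrow> complex"
  assumes "integrable lborel f"
  shows "integrable lborel (\<lambda>x. f x * exp (- (\<i> * complex_of_real (\<omega> \<bullet> x))))"
proof (rule Bochner_Integration.integrable_bound[OF assms])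
  show "(\<lambda>x. f x * exp (- (\<i> * complex_of_real (\<omega> \<bullet> x)))) \<in> borel_measurable lborel"
    using borel_measurable_integrable[OF assms] by measurable
qed (simp add: norm_mult)

lemma norm_fourier_le: "norm (fourier f \<omega>) \<le> (LINT x|lborel. norm (f x))"
  unfolding fourier_def
  by (rule order_trans[OF integral_norm_bound]) (simp add: norm_mult)

text \<open>
  This is Fubini's theorem. It serves twice: for the inversion theorem, and to move the Fourier transform
  from the symbol of the cone spline onto the test function.
\<close>

lemma fourier_multiplication_formula:
  fixes f g :: "'a::euclidean_space \<Rightarrow> complex"
  assumes f: "integrable lborel f" and g: "integrable lborel g"
  shows "(LINT \<omega>|lborel. fourier f \<omega> * g \<omega>) = (LINT x|lborel. f x * fourier g x)"
proof -
  have [measurable]: "f \<in> borel_measurable borel" "g \<in> borel_measurable borel"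
    using borel_measurable_integrable[OF f] borel_measurable_integrable[OF g] by simp_all
  define h where "h = (\<lambda>x \<omega>. f x * g \<omega> * exp (- (\<i> * complex_of_real (\<omega> \<bullet> x))))"
  have h: "integrable (lborel \<Otimes>\<^sub>M lborel) (\<lambda>(x, \<omega>). h x \<omega>)"
  proof (rule lborel_pair.Fubini_integrable)
    show "(\<lambda>(x, \<omega>). h x \<omega>) \<in> borel_measurable (lborel \<Otimes>\<^sub>M lborel)"
      unfolding h_def by measurable
    show "integrable lborel (\<lambda>x. LINT y|lborel. norm (case (x, y) of (x, \<omega>) \<Rightarrow> h x \<omega>))"
      using f by (simp add: h_def norm_mult)
    show "AE x in lborel. integrable lborel (\<lambda>y. case (x, y) of (x, \<omega>) \<Rightarrow> h x \<omega>)"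
    proof (rule AE_I2)
      fix x :: 'a
      show "integrable lborel (\<lambda>y. case (x, y) of (x, \<omega>) \<Rightarrow> h x \<omega>)"
        using integrable_mult_right[OF integrable_mult_character[OF g, of x], of "f x"]
        by (simp add: h_def mult_ac inner_commute)
    qed
  qed
  have "(LINT \<omega>|lborel. fourier f \<omega> * g \<omega>) = (LINT \<omega>|lborel. LINT x|lborel. h x \<omega>)"
  proof (rule Bochner_Integration.integral_cong[OF refl])
    fix \<omega> :: 'a
    show "fourier f \<omega> * g \<omega> = (LINT x|lborel. h x \<omega>)"
      unfolding fourier_def h_def integral_mult_left_zero[symmetric]
      by (simp add: mult_ac)
  qed
  also have "\<dots> = (LINT x|lborel. LINT \<omega>|lborel. h x \<omega>)"
    by (rule lborel_pair.Fubini_integral[OF h])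
  also have "\<dots> = (LINT x|lborel. f x * fourier g x)"
  proof (rule Bochner_Integration.integral_cong[OF refl])
    fix x :: 'a
    show "(LINT \<omega>|lborel. h x \<omega>) = f x * fourier g x"
      unfolding fourier_def h_def integral_mult_right_zero[symmetric]
      by (simp add: mult_ac inner_commute)
  qed
  finally show ?thesis .
qed

lemma norm_character_diff_le:
  "norm (exp (- (\<i> * complex_of_real a)) - exp (- (\<i> * complex_of_real b))) \<le> \<bar>a - b\<bar>"
proof -
  have "exp (- (\<i> * complex_of_real a)) - exp (- (\<i> * complex_of_real b)) =
        exp (- (\<i> * complex_of_real b)) * (exp (\<i> * complex_of_real (b - a)) - 1)"
    by (simp add: algebra_simps flip: exp_add)
  then have "norm (exp (- (\<i> * complex_of_real a)) - exp (- (\<i> * complex_of_real b))) =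
        2 * \<bar>sin ((b - a) / 2)\<bar>"
    by (simp only: norm_mult norm_exp_minus_i dist_exp_i_1)
  also have "\<dots> \<le> 2 * \<bar>(b - a) / 2\<bar>"
    by (intro mult_left_mono abs_sin_x_le_abs_x) auto
  finally show ?thesis by simp
qed

text \<open>
  The difference quotient may be taken under the integral: that of the character is bounded by
  \<open>2 * norm x\<close>, so \<open>2 * norm x * norm (f x)\<close> is an integrable majorant.
\<close>

lemma fourier_has_derivative:
  fixes f :: "'a::euclidean_space \<Rightarrow> complex"
  assumes f: "integrable lborel f" and xf: "integrable lborel (\<lambda>x. norm x * norm (f x))"
  shows "(fourier f has_derivative
           (\<lambda>h. fourier (\<lambda>x. - (\<i> * complex_of_real (h \<bullet> x)) * f x) \<omega>)) (at \<omega>)"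
proof -
  have [measurable]: "f \<in> borel_measurable borel"
    using borel_measurable_integrable[OF f] by simp
  define e where "e = (\<lambda>\<omega> x :: 'a. exp (- (\<i> * complex_of_real (\<omega> \<bullet> x))))"
  have em[measurable]: "(\<lambda>x. e \<omega> x) \<in> borel_measurable borel" for \<omega>
    unfolding e_def by measurable
  define D where "D = (\<lambda>h. fourier (\<lambda>x. - (\<i> * complex_of_real (h \<bullet> x)) * f x) \<omega>)"
  have int_D: "integrable lborel (\<lambda>x. complex_of_real (h \<bullet> x) * f x)" for h
  proof (rule Bochner_Integration.integrable_bound)
    show "integrable lborel (\<lambda>x. norm h * (norm x * norm (f x)))"
      using xf by simp
    show "AE x in lborel. norm (complex_of_real (h \<bullet> x) * f x) \<le> norm (norm h * (norm x * norm (f x)))"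
    proof (rule AE_I2)
      fix x :: 'a
      show "norm (complex_of_real (h \<bullet> x) * f x) \<le> norm (norm h * (norm x * norm (f x)))"
        using mult_right_mono[OF Cauchy_Schwarz_ineq2[of h x], of "norm (f x)"]
        by (simp add: norm_mult abs_mult mult_ac)
    qed
  qed measurable
  have int_D': "integrable lborel (\<lambda>x. - (\<i> * complex_of_real (h \<bullet> x)) * f x * e \<omega> x)" for h
    unfolding e_def
    using integrable_mult_character[OF integrable_mult_right[OF int_D[of h], of "-\<i>"], of \<omega>]
    by (simp add: mult_ac)
  have int_f: "integrable lborel (\<lambda>x. f x * e \<nu> x)" for \<nu>
    unfolding e_def by (rule integrable_mult_character[OF f])
  have D_eq: "D h = (LINT x|lborel. - (\<i> * complex_of_real (h \<bullet> x)) * f x * e \<omega> x)" for h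
    by (simp add: D_def fourier_def e_def)
  have "linear D"
  proof (rule linearI)
    fix h k :: 'a
    have "D h + D k = (LINT x|lborel. - (\<i> * complex_of_real (h \<bullet> x)) * f x * e \<omega> x + - (\<i> * complex_of_real (k \<bullet> x)) * f x * e \<omega> x)"
      unfolding D_eq by (rule Bochner_Integration.integral_add[symmetric]) (rule int_D')+
    also have "\<dots> = D (h + k)"
      unfolding D_eq by (intro Bochner_Integration.integral_cong refl) (simp add: inner_add_left algebra_simps)
    finally show "D (h + k) = D h + D k" ..
  next
    fix r and h :: 'a
    have "r *\<^sub>R D h = (LINT x|lborel. r *\<^sub>R (- (\<i> * complex_of_real (h \<bullet> x)) * f x * e \<omega> x))"
      unfolding D_eq by simp
    also have "\<dots> = D (r *\<^sub>R h)"
      unfolding D_eq by (intro Bochner_Integration.integral_cong refl) (simp add: scaleR_conv_of_real mult_ac)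
    finally show "D (r *\<^sub>R h) = r *\<^sub>R D h" ..
  qed
  then have blD: "bounded_linear D" by (simp add: linear_conv_bounded_linear)
  have "((\<lambda>y. norm ((fourier f y - fourier f \<omega>) - D (y - \<omega>)) / norm (y - \<omega>)) \<longlongrightarrow> 0) (at \<omega>)"
    unfolding tendsto_at_iff_sequentially
  proof (intro allI impI)
    fix Y :: "nat \<Rightarrow> 'a"
    assume Y: "\<forall>i. Y i \<in> UNIV - {\<omega>}" and lim: "Y \<longlonglongrightarrow> \<omega>"
    define q where "q = (\<lambda>n x. (e (Y n) x - e \<omega> x + \<i> * complex_of_real ((Y n - \<omega>) \<bullet> x) * e \<omega> x) / complex_of_real (norm (Y n - \<omega>)))"
    have "(\<lambda>n. LINT x|lborel. f x * q n x) \<longlonglongrightarrow> (LINT x|(lborel :: 'a measure). (0::complex))"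
    proof (rule integral_dominated_convergence[where w="\<lambda>x. 2 * (norm x * norm (f x))"])
      show "(\<lambda>x. 0) \<in> borel_measurable lborel" by simp
      show "(\<lambda>x. f x * q n x) \<in> borel_measurable lborel" for n
        unfolding q_def by measurable
      show "integrable lborel (\<lambda>x. 2 * (norm x * norm (f x)))" using xf by simp
      show "AE x in lborel. (\<lambda>n. f x * q n x) \<longlonglongrightarrow> 0"
      proof (rule AE_I2)
        fix x :: 'a
        have "((\<lambda>\<omega>. e \<omega> x) has_derivative (\<lambda>h. - (\<i> * complex_of_real (h \<bullet> x) * e \<omega> x))) (at \<omega>)"
        proof -
          have "((\<lambda>\<omega>. - (\<i> * complex_of_real (\<omega> \<bullet> x))) has_derivative (\<lambda>h. - (\<i> * complex_of_real (h \<bullet> x)))) (at \<omega>)"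
            by (auto intro!: derivative_eq_intros)
          from has_derivative_compose[OF this DERIV_exp[unfolded has_field_derivative_def]]
          show ?thesis by (simp add: e_def mult_ac)
        qed
        then have "((\<lambda>y. norm ((e y x - e \<omega> x) - (- (\<i> * complex_of_real ((y - \<omega>) \<bullet> x) * e \<omega> x))) / norm (y - \<omega>)) \<longlongrightarrow> 0) (at \<omega>)"
          unfolding has_derivative_iff_norm by simp
        then have "(\<lambda>n. norm (q n x)) \<longlonglongrightarrow> 0"
          unfolding tendsto_at_iff_sequentially q_def using Y lim
          by (auto simp: o_def norm_divide)
        then have "(\<lambda>n. q n x) \<longlonglongrightarrow> 0" by (simp add: tendsto_norm_zero_iff)
        then show "(\<lambda>n. f x * q n x) \<longlonglongrightarrow> 0" by (auto intro: tendsto_mult_right_zero)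
      qed
      show "AE x in lborel. norm (f x * q n x) \<le> 2 * (norm x * norm (f x))" for n
      proof (rule AE_I2)
        fix x :: 'a
        let ?d = "norm (Y n - \<omega>)"
        have d: "?d > 0" using Y by auto
        have cs: "\<bar>(Y n - \<omega>) \<bullet> x\<bar> \<le> ?d * norm x" by (rule Cauchy_Schwarz_ineq2)
        have "norm (e (Y n) x - e \<omega> x) \<le> ?d * norm x"
          using norm_character_diff_le[of "Y n \<bullet> x" "\<omega> \<bullet> x"] cs
          by (simp add: e_def inner_diff_left)
        moreover have "norm (\<i> * complex_of_real ((Y n - \<omega>) \<bullet> x) * e \<omega> x) \<le> ?d * norm x"
          using cs by (simp add: norm_mult e_def)
        ultimately have "norm (e (Y n) x - e \<omega> x + \<i> * complex_of_real ((Y n - \<omega>) \<bullet> x) * e \<omega> x) \<le> 2 * norm x * ?d"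
          by (intro order_trans[OF norm_triangle_ineq]) (simp add: mult_ac)
        then have "norm (q n x) \<le> 2 * norm x"
          using d by (simp add: q_def norm_divide divide_le_eq)
        then show "norm (f x * q n x) \<le> 2 * (norm x * norm (f x))"
          using mult_left_mono[of "norm (q n x)" "2 * norm x" "norm (f x)"]
          by (simp add: norm_mult mult_ac)
      qed
    qed
    moreover have "(LINT x|lborel. f x * q n x) =
      (fourier f (Y n) - fourier f \<omega> - D (Y n - \<omega>)) / complex_of_real (norm (Y n - \<omega>))" for n
    proof -
      have "fourier f (Y n) - fourier f \<omega> - D (Y n - \<omega>) =
        (LINT x|lborel. f x * e (Y n) x - f x * e \<omega> x - (- (\<i> * complex_of_real ((Y n - \<omega>) \<bullet> x)) * f x * e \<omega> x))"
        unfolding D_eq fourier_def e_def[symmetric, THEN fun_cong, THEN fun_cong]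
        by (simp only: Bochner_Integration.integral_diff Bochner_Integration.integrable_diff int_f int_D')
      also have "\<dots> / complex_of_real (norm (Y n - \<omega>)) = (LINT x|lborel. f x * q n x)"
        unfolding integral_divide_zero[symmetric]
        by (intro Bochner_Integration.integral_cong refl) (simp add: q_def algebra_simps diff_divide_distrib add_divide_distrib)
      finally show ?thesis ..
    qed
    ultimately have "(\<lambda>n. (fourier f (Y n) - fourier f \<omega> - D (Y n - \<omega>)) / complex_of_real (norm (Y n - \<omega>))) \<longlonglongrightarrow> 0"
      by simp
    then have "(\<lambda>n. norm ((fourier f (Y n) - fourier f \<omega> - D (Y n - \<omega>)) / complex_of_real (norm (Y n - \<omega>)))) \<longlonglongrightarrow> 0"
      by (rule tendsto_norm_zero)
    then show "((\<lambda>y. norm ((fourier f y - fourier f \<omega>) - D (y - \<omega>)) / norm (y - \<omega>)) \<circ> Y) \<longlonglongrightarrow> 0"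
      by (simp add: o_def norm_divide)
  qed
  then show ?thesis
    unfolding D_def[symmetric] has_derivative_iff_norm using blD by simp
qed

section \<open>Schwartz functions under differentiation, multiplication and the Fourier transform\<close>

definition rapidly_decreasing :: "('a::euclidean_space \<Rightarrow> complex) \<Rightarrow> bool" where
  "rapidly_decreasing f \<longleftrightarrow> (\<forall>N. bounded (range (\<lambda>x. (1 + norm x) ^ N * norm (f x))))"

lemma rapidly_decreasing_iff:
  "rapidly_decreasing f \<longleftrightarrow> (\<forall>N. \<exists>C. \<forall>x. (1 + norm x) ^ N * norm (f x) \<le> C)"
  by (auto simp: rapidly_decreasing_def bounded_iff abs_mult)

lemma rapidly_decreasing_add:
  assumes "rapidly_decreasing f" "rapidly_decreasing g"
  shows "rapidly_decreasing (\<lambda>x. f x + g x)"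
  unfolding rapidly_decreasing_iff
proof
  fix N
  obtain C D where C: "\<And>x. (1 + norm x) ^ N * norm (f x) \<le> C" and D: "\<And>x. (1 + norm x) ^ N * norm (g x) \<le> D"
    using assms unfolding rapidly_decreasing_iff by metis
  have "(1 + norm x) ^ N * norm (f x + g x) \<le> C + D" for x
  proof -
    have "(1 + norm x) ^ N * norm (f x + g x) \<le> (1 + norm x) ^ N * (norm (f x) + norm (g x))"
      by (intro mult_left_mono norm_triangle_ineq) auto
    also have "\<dots> \<le> C + D" using C[of x] D[of x] by (simp add: distrib_left)
    finally show ?thesis .
  qed
  then show "\<exists>C. \<forall>x. (1 + norm x) ^ N * norm (f x + g x) \<le> C" by blast
qed

lemma rapidly_decreasing_mult_linear_growth:
  assumes f: "rapidly_decreasing f" and p: "\<And>x. norm (p x) \<le> B * (1 + norm x)"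
  shows "rapidly_decreasing (\<lambda>x. p x * f x)"
  unfolding rapidly_decreasing_iff
proof
  fix N
  obtain C where C: "\<And>x. (1 + norm x) ^ Suc N * norm (f x) \<le> C"
    using f unfolding rapidly_decreasing_iff by metis
  have B: "B \<ge> 0" using p[of 0] norm_ge_zero[of "p 0"] by (simp del: norm_ge_zero)
  have "(1 + norm x) ^ N * norm (p x * f x) \<le> B * C" for x
  proof -
    have "(1 + norm x) ^ N * norm (p x * f x) \<le> (1 + norm x) ^ N * ((B * (1 + norm x)) * norm (f x))"
      unfolding norm_mult by (intro mult_left_mono mult_right_mono p) auto
    also have "\<dots> = B * ((1 + norm x) ^ Suc N * norm (f x))" by (simp add: mult_ac)
    also have "\<dots> \<le> B * C" by (intro mult_left_mono C B)
    finally show ?thesis .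
  qed
  then show "\<exists>C. \<forall>x. (1 + norm x) ^ N * norm (p x * f x) \<le> C" by blast
qed

lemma rapidly_decreasing_cmult:
  "rapidly_decreasing f \<Longrightarrow> rapidly_decreasing (\<lambda>x. c * f x)"
  by (rule rapidly_decreasing_mult_linear_growth[where B="norm c"]) (auto simp: mult_left_le algebra_simps)

lemma iter_deriv_dir_deriv: "iter_deriv bs (dir_deriv b f) = iter_deriv (bs @ [b]) f"
  by (simp add: iter_deriv_def)

lemma schwartz_altdef:
  "schwartz f \<longleftrightarrow> (\<forall>bs. set bs \<subseteq> Basis \<longrightarrow>
     (\<forall>x. iter_deriv bs f differentiable (at x)) \<and> rapidly_decreasing (iter_deriv bs f))"
  by (auto simp: schwartz_def smooth_def rapidly_decreasing_def)

lemma schwartz_differentiable: "schwartz f \<Longrightarrow> f differentiable (at x)"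
  by (metis schwartz_altdef empty_subsetI foldr_Nil id_apply iter_deriv_def list.set(1))

lemma schwartz_rapidly_decreasing: "schwartz f \<Longrightarrow> rapidly_decreasing f"
  by (metis schwartz_altdef empty_subsetI foldr_Nil id_apply iter_deriv_def list.set(1))

lemma schwartz_dir_deriv:
  assumes "schwartz f" "b \<in> Basis"
  shows "schwartz (dir_deriv b f)"
  unfolding schwartz_altdef iter_deriv_dir_deriv
  using assms unfolding schwartz_altdef by (metis Un_subset_iff empty_subsetI insert_subset list.simps(15) list.set(1) set_append)

text \<open>
  The Schwartz space is the largest class of differentiable, rapidly decreasing functions that is closed
  under partial derivatives. To show that a function is Schwartz it thus suffices to place it in
  some such class, which avoids Leibniz formulas for iterated derivatives.
\<close>

lemma schwartz_coinduct:
  assumes f: "P f"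
    and differentiable: "\<And>f x. P f \<Longrightarrow> f differentiable (at x)"
    and decreasing: "\<And>f. P f \<Longrightarrow> rapidly_decreasing f"
    and closed: "\<And>f b. P f \<Longrightarrow> b \<in> Basis \<Longrightarrow> P (dir_deriv b f)"
  shows "schwartz f"
proof -
  have "P (iter_deriv bs f)" if "set bs \<subseteq> Basis" for bs
    using that by (induction bs) (auto simp: iter_deriv_def f closed)
  then show ?thesis
    unfolding schwartz_altdef using differentiable decreasing by blast
qed

lemma has_derivative_imp_dir_deriv:
  "(f has_derivative f') (at x) \<Longrightarrow> dir_deriv b f x = f' b"
  unfolding dir_deriv_def using frechet_derivative_at by metis

lemma schwartz_has_derivative:
  "schwartz f \<Longrightarrow> (f has_derivative (\<lambda>h. dir_deriv h f x)) (at x)"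
  using schwartz_differentiable[of f x] unfolding dir_deriv_def frechet_derivative_works by simp

lemma schwartz_affine_combination:
  assumes "schwartz f" "schwartz g"
  shows "schwartz (\<lambda>x. c * f x + g x)"
proof (rule schwartz_coinduct[where P="\<lambda>h. \<exists>f g. schwartz f \<and> schwartz g \<and> h = (\<lambda>x. c * f x + g x)"])
  show "\<exists>f' g'. schwartz f' \<and> schwartz g' \<and> (\<lambda>x. c * f x + g x) = (\<lambda>x. c * f' x + g' x)"
    using assms by blast
next
  fix h :: "'a \<Rightarrow> complex" and x assume "\<exists>f g. schwartz f \<and> schwartz g \<and> h = (\<lambda>x. c * f x + g x)"
  then obtain f g where fg: "schwartz f" "schwartz g" "h = (\<lambda>x. c * f x + g x)" by blast
  show "h differentiable (at x)" unfolding fg(3)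
    by (intro differentiable_add differentiable_mult differentiable_const schwartz_differentiable fg)
next
  fix h :: "'a \<Rightarrow> complex" assume "\<exists>f g. schwartz f \<and> schwartz g \<and> h = (\<lambda>x. c * f x + g x)"
  then obtain f g where fg: "schwartz f" "schwartz g" "h = (\<lambda>x. c * f x + g x)" by blast
  show "rapidly_decreasing h" unfolding fg(3)
    by (intro rapidly_decreasing_add rapidly_decreasing_cmult schwartz_rapidly_decreasing fg)
next
  fix h :: "'a \<Rightarrow> complex" and b :: 'a
  assume "\<exists>f g. schwartz f \<and> schwartz g \<and> h = (\<lambda>x. c * f x + g x)" and b: "b \<in> Basis"
  then obtain f g where fg: "schwartz f" "schwartz g" "h = (\<lambda>x. c * f x + g x)" by blast
  have "dir_deriv b h x = c * dir_deriv b f x + dir_deriv b g x" for x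
    unfolding fg(3)
    by (rule has_derivative_imp_dir_deriv)
       (intro has_derivative_add has_derivative_mult_right schwartz_has_derivative fg)
  then have "dir_deriv b h = (\<lambda>x. c * dir_deriv b f x + dir_deriv b g x)" by blast
  then show "\<exists>f g. schwartz f \<and> schwartz g \<and> dir_deriv b h = (\<lambda>x. c * f x + g x)"
    using schwartz_dir_deriv fg b by blast
qed

lemma schwartz_zero: "schwartz (\<lambda>x::'a::euclidean_space. 0)"
proof (rule schwartz_coinduct[where P="\<lambda>h. h = (\<lambda>x. 0)"])
  show "\<And>h b. h = (\<lambda>x::'a. 0::complex) \<Longrightarrow> dir_deriv b h = (\<lambda>x. 0)"
    by (auto intro!: has_derivative_imp_dir_deriv)
qed (auto simp: rapidly_decreasing_def)

lemma schwartz_cmult: "schwartz f \<Longrightarrow> schwartz (\<lambda>x. c * f x)"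
  using schwartz_affine_combination[OF _ schwartz_zero, of f c] by simp

lemma schwartz_add: "schwartz f \<Longrightarrow> schwartz g \<Longrightarrow> schwartz (\<lambda>x. f x + g x)"
  using schwartz_affine_combination[of f g 1] by simp

text \<open>
  The functions \<open>(x \<bullet> v) * f x\<close> alone are not closed under differentiation because of the product
  rule; adding an arbitrary Schwartz function \<open>g\<close> makes the class closed.
\<close>

lemma schwartz_mult_coordinate:
  assumes "schwartz f"
  shows "schwartz (\<lambda>x. complex_of_real (x \<bullet> v) * f x)"
proof (rule schwartz_coinduct[where P="\<lambda>h. \<exists>f g. schwartz f \<and> schwartz g \<and> h = (\<lambda>x. complex_of_real (x \<bullet> v) * f x + g x)"])
  show "\<exists>f' g'. schwartz f' \<and> schwartz g' \<and> (\<lambda>x. complex_of_real (x \<bullet> v) * f x) = (\<lambda>x. complex_of_real (x \<bullet> v) * f' x + g' x)"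
    using assms schwartz_zero by (intro exI[of _ f] exI[of _ "\<lambda>x. 0"]) auto
next
  fix h :: "'a \<Rightarrow> complex" and x assume "\<exists>f g. schwartz f \<and> schwartz g \<and> h = (\<lambda>x. complex_of_real (x \<bullet> v) * f x + g x)"
  then obtain f g where fg: "schwartz f" "schwartz g" "h = (\<lambda>x. complex_of_real (x \<bullet> v) * f x + g x)" by blast
  have "(h has_derivative (\<lambda>t. complex_of_real (x \<bullet> v) * dir_deriv t f x + complex_of_real (t \<bullet> v) * f x + dir_deriv t g x)) (at x)"
    unfolding fg(3) by (auto intro!: derivative_eq_intros schwartz_has_derivative fg)
  then show "h differentiable (at x)" unfolding differentiable_def by blast
next
  fix h :: "'a \<Rightarrow> complex" assume "\<exists>f g. schwartz f \<and> schwartz g \<and> h = (\<lambda>x. complex_of_real (x \<bullet> v) * f x + g x)"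
  then obtain f g where fg: "schwartz f" "schwartz g" "h = (\<lambda>x. complex_of_real (x \<bullet> v) * f x + g x)" by blast
  have "norm (complex_of_real (x \<bullet> v)) \<le> norm v * (1 + norm x)" for x
    using Cauchy_Schwarz_ineq2[of x v] norm_ge_zero[of v] unfolding norm_of_real distrib_left by (simp add: mult_ac del: norm_ge_zero)
  then show "rapidly_decreasing h" unfolding fg(3)
    by (intro rapidly_decreasing_add schwartz_rapidly_decreasing rapidly_decreasing_mult_linear_growth[where B="norm v"] fg)
next
  fix h :: "'a \<Rightarrow> complex" and b :: 'a
  assume "\<exists>f g. schwartz f \<and> schwartz g \<and> h = (\<lambda>x. complex_of_real (x \<bullet> v) * f x + g x)" and b: "b \<in> Basis"
  then obtain f g where fg: "schwartz f" "schwartz g" "h = (\<lambda>x. complex_of_real (x \<bullet> v) * f x + g x)" by blast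
  have "dir_deriv b h x = complex_of_real (x \<bullet> v) * dir_deriv b f x + (complex_of_real (b \<bullet> v) * f x + dir_deriv b g x)" for x
    unfolding fg(3)
    by (rule has_derivative_imp_dir_deriv)
       (auto intro!: derivative_eq_intros schwartz_has_derivative fg)
  then have "dir_deriv b h = (\<lambda>x. complex_of_real (x \<bullet> v) * dir_deriv b f x + (complex_of_real (b \<bullet> v) * f x + dir_deriv b g x))" by blast
  moreover have "schwartz (\<lambda>x. complex_of_real (b \<bullet> v) * f x + dir_deriv b g x)"
    using fg b by (intro schwartz_affine_combination schwartz_dir_deriv)
  ultimately show "\<exists>f g. schwartz f \<and> schwartz g \<and> dir_deriv b h = (\<lambda>x. complex_of_real (x \<bullet> v) * f x + g x)"
    using schwartz_dir_deriv[OF fg(1) b] by blast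
qed

lemma schwartz_continuous: "schwartz f \<Longrightarrow> continuous_on A f"
  by (meson continuous_at_imp_continuous_on differentiable_imp_continuous_within schwartz_differentiable)

lemma schwartz_measurable: "schwartz f \<Longrightarrow> f \<in> borel_measurable borel"
  by (intro borel_measurable_continuous_onI schwartz_continuous)

lemma rapidly_decreasing_decay:
  fixes f :: "'a::euclidean_space \<Rightarrow> complex"
  assumes "rapidly_decreasing f"
  obtains C where "C \<ge> 0" "\<And>x. norm (f x) \<le> C * (1 / (1 + norm x) ^ N)"
proof -
  obtain C where C: "\<And>x. (1 + norm x) ^ N * norm (f x) \<le> C"
    using assms unfolding rapidly_decreasing_iff by metis
  have "C \<ge> 0" using C[of 0] by (simp add: order_trans[OF norm_ge_zero])
  moreover have "norm (f x) \<le> C * (1 / (1 + norm x) ^ N)" for x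
    using C[of x] by (simp add: field_simps add_nonneg_pos zero_less_power add_pos_nonneg)
  ultimately show ?thesis using that by blast
qed

lemma schwartz_integrable:
  fixes f :: "'a::euclidean_space \<Rightarrow> complex"
  assumes "schwartz f"
  shows "integrable lborel f"
proof -
  obtain C where C: "C \<ge> 0" "\<And>x. norm (f x) \<le> C * (1 / (1 + norm x) ^ (2 * DIM('a)))"
    using rapidly_decreasing_decay[OF schwartz_rapidly_decreasing[OF assms]] by metis
  show ?thesis
  proof (rule Bochner_Integration.integrable_bound)
    show "integrable lborel (\<lambda>x::'a. C * (1 / (1 + norm x) ^ (2 * DIM('a))))"
      by (intro integrable_mult_right integrable_polynomial_decay)
    show "f \<in> borel_measurable lborel" using schwartz_measurable[OF assms] by simp
    show "AE x in lborel. norm (f x) \<le> norm (C * (1 / (1 + norm x) ^ (2 * DIM('a))))"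
      using C by (auto intro!: AE_I2 order_trans[OF C(2)])
  qed
qed

lemma schwartz_integrable_norm_mult:
  fixes f :: "'a::euclidean_space \<Rightarrow> complex"
  assumes "schwartz f"
  shows "integrable lborel (\<lambda>x. norm x * norm (f x))"
proof (rule Bochner_Integration.integrable_bound)
  show "integrable lborel (\<lambda>x. \<Sum>b\<in>Basis. norm (complex_of_real (x \<bullet> b) * f x))"
    using assms by (intro Bochner_Integration.integrable_sum integrable_norm schwartz_integrable schwartz_mult_coordinate)
  show "(\<lambda>x. norm x * norm (f x)) \<in> borel_measurable lborel"
    using schwartz_measurable[OF assms] by measurable
  show "AE x in lborel. norm (norm x * norm (f x)) \<le> norm (\<Sum>b\<in>Basis. norm (complex_of_real (x \<bullet> b) * f x))"
  proof (rule AE_I2)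
    fix x :: 'a
    have "norm x * norm (f x) \<le> (\<Sum>b\<in>Basis. \<bar>x \<bullet> b\<bar>) * norm (f x)"
      by (intro mult_right_mono norm_le_l1) auto
    then show "norm (norm x * norm (f x)) \<le> norm (\<Sum>b\<in>Basis. norm (complex_of_real (x \<bullet> b) * f x))"
      by (simp add: norm_mult sum_distrib_right sum_nonneg)
  qed
qed

lemma has_derivative_fourier_schwartz:
  assumes "schwartz f"
  shows "(fourier f has_derivative (\<lambda>h. fourier (\<lambda>x. - \<i> * (complex_of_real (x \<bullet> h) * f x)) \<omega>)) (at \<omega>)"
  using fourier_has_derivative[OF schwartz_integrable schwartz_integrable_norm_mult, OF assms assms, of \<omega>]
  by (simp add: inner_commute mult_ac)

lemma norm_diff_quotient_le:
  fixes f :: "'a::real_normed_vector \<Rightarrow> complex"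
  assumes f: "\<And>x. (f has_derivative f' x) (at x)" and h: "h > 0"
    and B: "\<And>s. 0 < s \<Longrightarrow> s < h \<Longrightarrow> norm (f' (x + s *\<^sub>R b) b) \<le> B"
  shows "norm ((f (x + h *\<^sub>R b) - f x) /\<^sub>R h) \<le> (B::real)"
proof -
  have d: "((\<lambda>s. f (x + s *\<^sub>R b)) has_derivative (\<lambda>t. f' (x + s *\<^sub>R b) (t *\<^sub>R b))) (at s)" for s
    by (rule has_derivative_compose[OF _ f]) (auto intro!: derivative_eq_intros)
  have "\<exists>s\<in>{0<..<h}. norm (f (x + h *\<^sub>R b) - f (x + 0 *\<^sub>R b)) \<le> norm (f' (x + s *\<^sub>R b) ((h - 0) *\<^sub>R b))"
    using h d by (intro mvt_general[where f="\<lambda>s. f (x + s *\<^sub>R b)"])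
      (auto intro!: continuous_at_imp_continuous_on has_derivative_continuous)
  then obtain s where s: "0 < s" "s < h" "norm (f (x + h *\<^sub>R b) - f x) \<le> norm (f' (x + s *\<^sub>R b) (h *\<^sub>R b))"
    by auto
  have "linear (f' (x + s *\<^sub>R b))" using f has_derivative_linear by blast
  then have "norm (f' (x + s *\<^sub>R b) (h *\<^sub>R b)) = h * norm (f' (x + s *\<^sub>R b) b)"
    using h by (simp add: linear_cmul)
  also have "\<dots> \<le> h * B" using B[OF s(1,2)] h by simp
  finally have "norm (f (x + h *\<^sub>R b) - f x) / h \<le> B"
    using s(3) h by (simp add: divide_le_eq mult.commute)
  then show ?thesis using h by (simp add: divide_inverse mult.commute)
qed

lemma fourier_translate:
  fixes f :: "'a::euclidean_space \<Rightarrow> complex"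
  assumes [measurable]: "f \<in> borel_measurable borel"
  shows "fourier (\<lambda>x. f (x + a)) \<omega> = exp (\<i> * complex_of_real (\<omega> \<bullet> a)) * fourier f \<omega>"
proof -
  have "fourier f \<omega> = (LINT x|distr lborel borel ((+) a). f x * exp (- (\<i> * complex_of_real (\<omega> \<bullet> x))))"
    by (simp add: lborel_distr_plus fourier_def)
  also have "\<dots> = (LINT x|lborel. f (a + x) * exp (- (\<i> * complex_of_real (\<omega> \<bullet> (a + x)))))"
    by (subst integral_distr) auto
  finally have "exp (\<i> * complex_of_real (\<omega> \<bullet> a)) * fourier f \<omega> =
      (LINT x|lborel. exp (\<i> * complex_of_real (\<omega> \<bullet> a)) * (f (a + x) * exp (- (\<i> * complex_of_real (\<omega> \<bullet> (a + x))))))"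
    by simp
  also have "\<dots> = fourier (\<lambda>x. f (x + a)) \<omega>"
    unfolding fourier_def
  proof (intro Bochner_Integration.integral_cong refl)
    fix x
    have "exp (\<i> * complex_of_real (\<omega> \<bullet> a)) * exp (- (\<i> * complex_of_real (\<omega> \<bullet> (a + x)))) = exp (- (\<i> * complex_of_real (\<omega> \<bullet> x)))"
      by (simp add: inner_add_right algebra_simps flip: exp_add)
    then show "exp (\<i> * complex_of_real (\<omega> \<bullet> a)) * (f (a + x) * exp (- (\<i> * complex_of_real (\<omega> \<bullet> (a + x))))) = f (x + a) * exp (- (\<i> * complex_of_real (\<omega> \<bullet> x)))"
      by (simp add: add.commute mult_ac)
  qed
  finally show ?thesis ..
qed

text \<open>
  Integration by parts, obtained from translation invariance: the Fourier transform of
  \<open>(f (x + h *\<^sub>R b) - f x) / h\<close> is \<open>(exp (\<i> h (\<omega> \<bullet> b)) - 1) / h\<close> times that of \<open>f\<close>,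
  and both sides converge as \<open>h\<close> tends to 0.
\<close>

lemma fourier_dir_deriv:
  fixes f :: "'a::euclidean_space \<Rightarrow> complex"
  assumes f: "schwartz f" and b: "b \<in> Basis"
  shows "fourier (dir_deriv b f) \<omega> = \<i> * complex_of_real (\<omega> \<bullet> b) * fourier f \<omega>"
proof -
  define h where "h = (\<lambda>n. 1 / real (Suc n))"
  have h: "h n > 0" "h n \<le> 1" for n by (auto simp: h_def)
  have h0: "h \<longlonglongrightarrow> 0" unfolding h_def by (rule LIMSEQ_inverse_real_of_nat[unfolded inverse_eq_divide])
  have at0: "filterlim h (at 0) sequentially"
    using h0 h(1) by (auto simp: filterlim_at intro!: always_eventually less_imp_neq[symmetric])
  have fm[measurable]: "f \<in> borel_measurable borel" using f by (rule schwartz_measurable)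
  have dm[measurable]: "dir_deriv b f \<in> borel_measurable borel"
    using schwartz_dir_deriv[OF f b] by (rule schwartz_measurable)
  let ?M = "2 * DIM('a)"
  obtain C where C: "C \<ge> 0" "\<And>x. norm (dir_deriv b f x) \<le> C * (1 / (1 + norm x) ^ ?M)"
    using rapidly_decreasing_decay[OF schwartz_rapidly_decreasing[OF schwartz_dir_deriv[OF f b]]] by metis
  define q where "q = (\<lambda>n x. (f (x + h n *\<^sub>R b) - f x) /\<^sub>R h n)"
  have "(\<lambda>n. fourier (q n) \<omega>) \<longlonglongrightarrow> fourier (dir_deriv b f) \<omega>"
    unfolding fourier_def
  proof (rule integral_dominated_convergence[where w="\<lambda>x. C * 2 ^ ?M * (1 / (1 + norm x) ^ ?M)"])
    show "(\<lambda>x. dir_deriv b f x * exp (- (\<i> * complex_of_real (\<omega> \<bullet> x)))) \<in> borel_measurable lborel"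
      by measurable
    show "(\<lambda>x. q n x * exp (- (\<i> * complex_of_real (\<omega> \<bullet> x)))) \<in> borel_measurable lborel" for n
      unfolding q_def by measurable
    show "integrable lborel (\<lambda>x::'a. C * 2 ^ ?M * (1 / (1 + norm x) ^ ?M))"
      by (intro integrable_mult_right integrable_polynomial_decay)
    show "AE x in lborel. (\<lambda>n. q n x * exp (- (\<i> * complex_of_real (\<omega> \<bullet> x)))) \<longlonglongrightarrow>
       dir_deriv b f x * exp (- (\<i> * complex_of_real (\<omega> \<bullet> x)))"
    proof (rule AE_I2)
      fix x :: 'a
      have "((\<lambda>s. f (x + s *\<^sub>R b)) has_derivative (\<lambda>t. dir_deriv (t *\<^sub>R b) f (x + 0 *\<^sub>R b))) (at 0)"
        by (rule has_derivative_compose[OF _ schwartz_has_derivative[OF f]]) (auto intro!: derivative_eq_intros)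
      moreover have "dir_deriv (t *\<^sub>R b) f x = t *\<^sub>R dir_deriv b f x" for t
        using has_derivative_linear[OF schwartz_has_derivative[OF f, of x]] by (rule linear_cmul)
      ultimately have "((\<lambda>s. f (x + s *\<^sub>R b)) has_vector_derivative dir_deriv b f x) (at 0)"
        by (simp add: has_vector_derivative_def)
      then have "((\<lambda>s. norm (f (x + s *\<^sub>R b) - f x - s *\<^sub>R dir_deriv b f x) / norm s) \<longlongrightarrow> 0) (at 0)"
        by (simp add: has_vector_derivative_def has_derivative_iff_norm)
      then have "(\<lambda>n. norm (f (x + h n *\<^sub>R b) - f x - h n *\<^sub>R dir_deriv b f x) / norm (h n)) \<longlonglongrightarrow> 0"
        by (rule filterlim_compose[OF _ at0])
      moreover have "norm (f (x + h n *\<^sub>R b) - f x - h n *\<^sub>R dir_deriv b f x) / norm (h n) = norm (q n x - dir_deriv b f x)" for n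
      proof -
        have "f (x + h n *\<^sub>R b) - f x - h n *\<^sub>R dir_deriv b f x = h n *\<^sub>R (q n x - dir_deriv b f x)"
          using h(1)[of n] by (simp add: q_def scaleR_diff_right)
        then show ?thesis using h(1)[of n] by simp
      qed
      ultimately have "(\<lambda>n. q n x) \<longlonglongrightarrow> dir_deriv b f x"
        by (simp add: tendsto_norm_zero_iff LIM_zero_iff)
      then show "(\<lambda>n. q n x * exp (- (\<i> * complex_of_real (\<omega> \<bullet> x)))) \<longlonglongrightarrow>
       dir_deriv b f x * exp (- (\<i> * complex_of_real (\<omega> \<bullet> x)))"
        by (intro tendsto_intros)
    qed
    show "AE x in lborel. norm (q n x * exp (- (\<i> * complex_of_real (\<omega> \<bullet> x)))) \<le> C * 2 ^ ?M * (1 / (1 + norm x) ^ ?M)" for n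
    proof (rule AE_I2)
      fix x :: 'a
      have "norm (q n x) \<le> C * 2 ^ ?M * (1 / (1 + norm x) ^ ?M)"
        unfolding q_def
      proof (rule norm_diff_quotient_le[OF schwartz_has_derivative[OF f] h(1)])
        fix s assume s: "0 < s" "s < h n"
        have "norm x \<le> norm (x + s *\<^sub>R b) + norm (s *\<^sub>R b)"
          using norm_triangle_ineq4[of "x + s *\<^sub>R b" "s *\<^sub>R b"] by simp
        moreover have "norm (s *\<^sub>R b) \<le> 1" using s h(2)[of n] b by simp
        moreover have "1 + p \<le> 2 * (1 + q)" if "p \<le> q + r" "r \<le> 1" "0 \<le> q" for p q r :: real
          using that by simp
        ultimately have "1 + norm x \<le> 2 * (1 + norm (x + s *\<^sub>R b))" using norm_ge_zero by blast
        \<comment> \<open>Shifting by at most a unit vector costs a factor 2 in the decay, so one majorant serves all quotients.\<close>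
        then have "(1 + norm x) ^ ?M \<le> (2 * (1 + norm (x + s *\<^sub>R b))) ^ ?M"
          by (intro power_mono) auto
        then have "(1 + norm x) ^ ?M \<le> 2 ^ ?M * (1 + norm (x + s *\<^sub>R b)) ^ ?M"
          by (simp only: power_mult_distrib)
        moreover have "(1 + norm x) ^ ?M > 0" "(1 + norm (x + s *\<^sub>R b)) ^ ?M > 0"
          by (intro zero_less_power add_pos_nonneg; simp)+
        ultimately have "1 / (1 + norm (x + s *\<^sub>R b)) ^ ?M \<le> 2 ^ ?M * (1 / (1 + norm x) ^ ?M)"
          by (simp add: field_simps)
        then have "C * (1 / (1 + norm (x + s *\<^sub>R b)) ^ ?M) \<le> C * (2 ^ ?M * (1 / (1 + norm x) ^ ?M))"
          by (rule mult_left_mono) (rule C(1))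
        with C(2)[of "x + s *\<^sub>R b"]
        show "norm (dir_deriv b f (x + s *\<^sub>R b)) \<le> C * 2 ^ ?M * (1 / (1 + norm x) ^ ?M)"
          by (simp only: mult.assoc)
      qed
      then show "norm (q n x * exp (- (\<i> * complex_of_real (\<omega> \<bullet> x)))) \<le> C * 2 ^ ?M * (1 / (1 + norm x) ^ ?M)"
        by (simp add: norm_mult)
    qed
  qed
  moreover have "(\<lambda>n. fourier (q n) \<omega>) \<longlonglongrightarrow> \<i> * complex_of_real (\<omega> \<bullet> b) * fourier f \<omega>"
  proof -
    \<comment> \<open>The character picks up the factor \<open>exp (\<i> h (\<omega> \<bullet> b))\<close> under translation.\<close>
    have eq: "fourier (q n) \<omega> = ((exp (\<i> * complex_of_real (h n * (\<omega> \<bullet> b))) - 1) / complex_of_real (h n)) * fourier f \<omega>" for n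
    proof -
      have int: "integrable lborel (\<lambda>x. f (x + h n *\<^sub>R b))"
      proof -
        have "integrable (distr lborel borel ((+) (h n *\<^sub>R b))) f"
          using schwartz_integrable[OF f] by (simp add: lborel_distr_plus)
        then show ?thesis by (subst (asm) integrable_distr_eq) (auto simp: add.commute)
      qed
      have "fourier (q n) \<omega> = (LINT x|lborel. (f (x + h n *\<^sub>R b) * exp (- (\<i> * complex_of_real (\<omega> \<bullet> x))) - f x * exp (- (\<i> * complex_of_real (\<omega> \<bullet> x)))) / complex_of_real (h n))"
        unfolding fourier_def q_def
        by (intro Bochner_Integration.integral_cong refl) (simp add: scaleR_conv_of_real field_simps)
      also have "\<dots> = (fourier (\<lambda>x. f (x + h n *\<^sub>R b)) \<omega> - fourier f \<omega>) / complex_of_real (h n)"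
        unfolding fourier_def integral_divide_zero
        by (subst Bochner_Integration.integral_diff[OF integrable_mult_character[OF int] integrable_mult_character[OF schwartz_integrable[OF f]]]) simp
      also have "fourier (\<lambda>x. f (x + h n *\<^sub>R b)) \<omega> = exp (\<i> * complex_of_real (h n * (\<omega> \<bullet> b))) * fourier f \<omega>"
        by (subst fourier_translate) auto
      finally show ?thesis by (simp add: algebra_simps diff_divide_distrib)
    qed
    have lim: "(\<lambda>n. (exp (\<i> * complex_of_real (h n * (\<omega> \<bullet> b))) - 1) / complex_of_real (h n)) \<longlonglongrightarrow> \<i> * complex_of_real (\<omega> \<bullet> b)"
    proof -
      have "((\<lambda>z. exp (\<i> * (z * complex_of_real (\<omega> \<bullet> b)))) has_field_derivative \<i> * complex_of_real (\<omega> \<bullet> b)) (at 0)"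
        by (auto intro!: derivative_eq_intros)
      then have "((\<lambda>z. (exp (\<i> * (z * complex_of_real (\<omega> \<bullet> b))) - 1) / z) \<longlongrightarrow> \<i> * complex_of_real (\<omega> \<bullet> b)) (at 0)"
        by (simp add: has_field_derivative_iff)
      moreover have "filterlim (\<lambda>n. complex_of_real (h n)) (at 0) sequentially"
        using h0 h(1) by (auto simp: filterlim_at intro!: always_eventually less_imp_neq[symmetric] tendsto_eq_intros)
      ultimately have "(\<lambda>n. (exp (\<i> * (complex_of_real (h n) * complex_of_real (\<omega> \<bullet> b))) - 1) / complex_of_real (h n)) \<longlonglongrightarrow> \<i> * complex_of_real (\<omega> \<bullet> b)"
        by (rule filterlim_compose)
      then show ?thesis by simp
    qed
    show ?thesis unfolding eq by (intro tendsto_mult lim tendsto_const)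
  qed
  ultimately show ?thesis using LIMSEQ_unique by blast
qed

text \<open>
  Each factor \<open>1 + norm \<omega>\<close> is at most \<open>1 + \<Sum>b. \<bar>\<omega> \<bullet> b\<bar>\<close>, and \<open>\<omega> \<bullet> b\<close> is absorbed by passing from
  \<open>f\<close> to a partial derivative of \<open>f\<close>. Hence the induction over all Schwartz functions at once.
\<close>

lemma fourier_schwartz_polynomial_bound:
  fixes f :: "'a::euclidean_space \<Rightarrow> complex"
  assumes "schwartz f"
  shows "\<exists>C. \<forall>\<omega>. (1 + norm \<omega>) ^ N * norm (fourier f \<omega>) \<le> C"
  using assms
proof (induction N arbitrary: f)
  case 0
  then show ?case using norm_fourier_le[of f] by auto
next
  case (Suc N)
  obtain C where C: "\<And>\<omega>. (1 + norm \<omega>) ^ N * norm (fourier f \<omega>) \<le> C"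
    using Suc by metis
  have "\<forall>b\<in>(Basis :: 'a set). \<exists>C. \<forall>\<omega>. (1 + norm \<omega>) ^ N * norm (fourier (dir_deriv b f) \<omega>) \<le> C"
    using Suc.IH schwartz_dir_deriv[OF Suc.prems] by blast
  then obtain D where D: "\<And>b \<omega>. b \<in> (Basis :: 'a set) \<Longrightarrow> (1 + norm \<omega>) ^ N * norm (fourier (dir_deriv b f) \<omega>) \<le> D b"
    by metis
  have "(1 + norm \<omega>) ^ Suc N * norm (fourier f \<omega>) \<le> C + (\<Sum>b\<in>Basis. D b)" for \<omega> :: 'a
  proof -
    have "(1 + norm \<omega>) ^ Suc N * norm (fourier f \<omega>) = (1 + norm \<omega>) ^ N * norm (fourier f \<omega>) * (1 + norm \<omega>)"
      by simp
    also have "\<dots> \<le> (1 + norm \<omega>) ^ N * norm (fourier f \<omega>) * (1 + (\<Sum>b\<in>Basis. \<bar>\<omega> \<bullet> b\<bar>))"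
      by (intro mult_left_mono add_left_mono norm_le_l1) auto
    also have "\<dots> = (1 + norm \<omega>) ^ N * norm (fourier f \<omega>) + (\<Sum>b\<in>Basis. (1 + norm \<omega>) ^ N * norm (fourier (dir_deriv b f) \<omega>))"
      by (simp add: fourier_dir_deriv[OF Suc.prems] norm_mult distrib_left sum_distrib_left mult_ac)
    also have "\<dots> \<le> C + (\<Sum>b\<in>Basis. D b)"
      by (intro add_mono C sum_mono D)
    finally show ?thesis .
  qed
  then show ?case by blast
qed

lemma schwartz_fourier:
  assumes "schwartz f"
  shows "schwartz (fourier f)"
proof (rule schwartz_coinduct[where P="\<lambda>g. \<exists>f. schwartz f \<and> g = fourier f"])
  show "\<exists>f'. schwartz f' \<and> fourier f = fourier f'" using assms by blast
next
  fix g :: "'a \<Rightarrow> complex" and x assume "\<exists>f. schwartz f \<and> g = fourier f"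
  then show "g differentiable (at x)"
    unfolding differentiable_def using has_derivative_fourier_schwartz by blast
next
  fix g :: "'a \<Rightarrow> complex" assume "\<exists>f. schwartz f \<and> g = fourier f"
  then show "rapidly_decreasing g"
    unfolding rapidly_decreasing_iff using fourier_schwartz_polynomial_bound by blast
next
  fix g :: "'a \<Rightarrow> complex" and b :: 'a
  assume "\<exists>f. schwartz f \<and> g = fourier f" "b \<in> Basis"
  then obtain f where f: "schwartz f" "g = fourier f" by blast
  have "dir_deriv b g = fourier (\<lambda>x. - \<i> * (complex_of_real (x \<bullet> b) * f x))"
    unfolding f(2) using has_derivative_imp_dir_deriv[OF has_derivative_fourier_schwartz[OF f(1)]] by blast
  then show "\<exists>f. schwartz f \<and> dir_deriv b g = fourier f"
    using schwartz_cmult[OF schwartz_mult_coordinate[OF f(1)]] by blast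
qed

section \<open>Gamma densities and their Fourier transforms\<close>

text \<open>
  For \<open>\<epsilon> = 1\<close> this is the density of the Gamma distribution; in general it is the truncated power
  \<open>t\<^sub>+\<close> to the \<open>a - 1\<close>, divided by \<open>\<Gamma>(a)\<close> and damped by \<open>exp (- \<epsilon> t)\<close>. The damping is
  left unnormalised, so that \<open>\<epsilon> = 0\<close> gives the one-variable spline itself.
\<close>

definition gamma_density :: "real \<Rightarrow> real \<Rightarrow> real \<Rightarrow> real" where
  "gamma_density a \<epsilon> t = (if t > 0 then t powr (a - 1) * exp (- (\<epsilon> * t)) / Gamma a else 0)"

lemma gamma_density_measurable [measurable]: "gamma_density a \<epsilon> \<in> borel_measurable borel"
  unfolding gamma_density_def[abs_def] by measurable

lemma gamma_density_nonneg: "a > 0 \<Longrightarrow> gamma_density a \<epsilon> t \<ge> 0"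
  by (simp add: gamma_density_def Gamma_real_pos less_imp_le)

lemma gamma_density_step:
  assumes "a > 0"
  shows "t * gamma_density a \<epsilon> t = a * gamma_density (a + 1) \<epsilon> t"
proof (cases "t > 0")
  case True
  have "t powr a = t * t powr (a - 1)" using True by (simp add: powr_diff)
  moreover have "Gamma (a + 1) = a * Gamma a" using assms by (intro Gamma_plus1) (auto elim!: nonpos_Ints_cases)
  ultimately show ?thesis using True assms by (simp add: gamma_density_def)
qed (simp add: gamma_density_def)

lemma gamma_density_integrable:
  assumes a: "a > 0" and e: "\<epsilon> > 0"
  shows "integrable lborel (gamma_density a \<epsilon>)"
proof -
  have "(\<lambda>t. complex_of_real t powr (complex_of_real a - 1) / of_real (exp (\<epsilon> * t))) absolutely_integrable_on {0<..}"
    using assms by (intro absolutely_integrable_Gamma_integral) auto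
  then have "integrable lebesgue (\<lambda>t. norm (indicator {0<..} t *\<^sub>R (complex_of_real t powr (complex_of_real a - 1) / of_real (exp (\<epsilon> * t)))))"
    unfolding set_integrable_def by (rule integrable_norm)
  then have "integrable lebesgue (\<lambda>t. norm (indicator {0<..} t *\<^sub>R (complex_of_real t powr (complex_of_real a - 1) / of_real (exp (\<epsilon> * t)))) / Gamma a)"
    by simp
  also have "(\<lambda>t. norm (indicator {0<..} t *\<^sub>R (complex_of_real t powr (complex_of_real a - 1) / of_real (exp (\<epsilon> * t)))) / Gamma a) = gamma_density a \<epsilon>"
    by (rule ext) (simp add: gamma_density_def indicator_def norm_divide norm_mult norm_inverse norm_powr_real_powr exp_minus divide_inverse)
  finally show ?thesis by (subst (asm) integrable_completion) auto
qed

lemma gamma_density_integral_1: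
  assumes a: "a > 0"
  shows "(LINT t|lborel. gamma_density a 1 t) = 1"
proof -
  have "(gamma_density a 1 has_integral (LINT t|lborel. gamma_density a 1 t)) UNIV"
    using gamma_density_integrable[OF a, of 1] by (intro has_integral_integral_lborel) auto
  moreover have "(gamma_density a 1 has_integral 1) UNIV"
  proof -
    have "((\<lambda>t. t powr (a - 1) / exp t / Gamma a) has_integral Gamma a / Gamma a) {0..}"
      by (intro has_integral_divide Gamma_integral_real a)
    then have "((\<lambda>t. t powr (a - 1) / exp t / Gamma a) has_integral 1) {0..}"
      using Gamma_real_pos[OF a] by simp
    then have "((\<lambda>t. if t \<in> {0..} then t powr (a - 1) / exp t / Gamma a else 0) has_integral 1) UNIV"
      by (simp only: has_integral_restrict_UNIV)
    then show ?thesis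
      by (rule has_integral_spike[where S="{0}", rotated -1]) (auto simp: gamma_density_def exp_minus divide_inverse)
  qed
  ultimately show ?thesis by (rule has_integral_unique)
qed

lemma gamma_density_integral:
  assumes a: "a > 0" and e: "\<epsilon> > 0"
  shows "(LINT t|lborel. gamma_density a \<epsilon> t) = \<epsilon> powr - a"
proof -
  have "1 = \<epsilon> * (LINT t|lborel. gamma_density a 1 (\<epsilon> * t))"
    using lborel_integral_real_affine[of \<epsilon> "gamma_density a 1" 0] e gamma_density_integral_1[OF a] by simp
  also have "(\<lambda>t. gamma_density a 1 (\<epsilon> * t)) = (\<lambda>t. \<epsilon> powr (a - 1) * gamma_density a \<epsilon> t)"
    using e by (auto simp: gamma_density_def powr_mult zero_less_mult_iff)
  also have "\<epsilon> * (LINT t|lborel. \<epsilon> powr (a - 1) * gamma_density a \<epsilon> t) = \<epsilon> powr a * (LINT t|lborel. gamma_density a \<epsilon> t)"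
    using e by (simp add: powr_diff)
  finally show ?thesis using e by (simp add: powr_minus field_simps)
qed

abbreviation gamma_transform :: "real \<Rightarrow> real \<Rightarrow> real \<Rightarrow> complex" where
  "gamma_transform a \<epsilon> \<equiv> fourier (\<lambda>t. complex_of_real (gamma_density a \<epsilon> t))"

text \<open>
  The integral over \<open>t > 0\<close> of the derivative of \<open>t powr a * exp (- (\<epsilon> + \<i> u) t)\<close> vanishes, because
  that function tends to 0 at both ends.
\<close>

lemma gamma_transform_step:
  assumes a: "a > 0" and e: "\<epsilon> > 0"
  shows "(complex_of_real \<epsilon> + \<i> * complex_of_real u) * gamma_transform (a + 1) \<epsilon> u = gamma_transform a \<epsilon> u"
proof -
  define s where "s = complex_of_real \<epsilon> + \<i> * complex_of_real u"
  define H where "H = (\<lambda>t. complex_of_real (t powr a / Gamma (a + 1)) * exp (- (s * complex_of_real t)))"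
  define f where "f = (\<lambda>t. (complex_of_real (gamma_density a \<epsilon> t) - s * complex_of_real (gamma_density (a + 1) \<epsilon> t)) * exp (- (\<i> * complex_of_real (u \<bullet> t))))"
  have int: "integrable lborel (\<lambda>t. complex_of_real (gamma_density a \<epsilon> t))" "integrable lborel (\<lambda>t. complex_of_real (gamma_density (a + 1) \<epsilon> t))"
    using assms by (auto intro!: integrable_of_real gamma_density_integrable)
  have int_f: "integrable lborel f"
    unfolding f_def using int by (intro integrable_mult_character Bochner_Integration.integrable_diff integrable_mult_right)
  have Gp: "Gamma (a + 1) = a * Gamma a" using a by (intro Gamma_plus1) (auto elim!: nonpos_Ints_cases)
  then have Gp': "Gamma (1 + a) = a * Gamma a" by (simp add: add.commute)
  have Ga: "Gamma a > 0" using a by (rule Gamma_real_pos)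
  have Gap: "Gamma (a + 1) > 0" using a by (intro Gamma_real_pos) simp
  have exp_s: "exp (- (s * complex_of_real t)) = complex_of_real (exp (- (\<epsilon> * t))) * exp (- (\<i> * complex_of_real (u \<bullet> t)))" for t
    by (simp add: s_def exp_of_real[symmetric] algebra_simps flip: exp_add)
  have f_eq: "f t = (complex_of_real (a * t powr (a - 1) / Gamma (a + 1)) - s * complex_of_real (t powr a / Gamma (a + 1))) * exp (- (s * complex_of_real t))" if "t > 0" for t
    using that a Ga unfolding f_def exp_s by (simp add: gamma_density_def Gp Gp' field_simps)
  have "(LBINT t=0..\<infinity>. f t) = 0 - 0"
  proof (rule interval_integral_FTC_integrable)
    show "(H has_vector_derivative f t) (at t)" if "0 < ereal t" for t
    proof -
      have t: "t > 0" using that by simp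
      have 1: "((\<lambda>t. t powr a / Gamma (a + 1)) has_real_derivative a * t powr (a - 1) / Gamma (a + 1)) (at t)"
        using t Gap by (auto intro!: derivative_eq_intros)
      have 2: "((\<lambda>t. exp (- (s * complex_of_real t))) has_vector_derivative - s * exp (- (s * complex_of_real t))) (at t)"
        by (rule has_vector_derivative_real_field) (auto intro!: derivative_eq_intros)
      show ?thesis
        unfolding H_def f_eq[OF t]
        using has_vector_derivative_mult[OF has_vector_derivative_of_real[OF 1] 2]
        by (simp add: algebra_simps)
    qed
    show "isCont f t" if "0 < ereal t" for t
    proof -
      have t: "t > 0" using that by simp
      have "isCont (\<lambda>t. (complex_of_real (a * t powr (a - 1) / Gamma (a + 1)) - s * complex_of_real (t powr a / Gamma (a + 1))) * exp (- (s * complex_of_real t))) t"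
        using t Gap by (auto intro!: continuous_intros)
      moreover have "\<forall>\<^sub>F t in nhds t. f t = (complex_of_real (a * t powr (a - 1) / Gamma (a + 1)) - s * complex_of_real (t powr a / Gamma (a + 1))) * exp (- (s * complex_of_real t))"
        using t by (intro eventually_mono[OF eventually_nhds_in_open[of "{0<..}"]] f_eq) auto
      ultimately show ?thesis by (subst isCont_cong) auto
    qed
    show "set_integrable lborel (einterval 0 \<infinity>) f"
      unfolding set_integrable_def by (intro integrable_mult_indicator int_f) auto
    have nH: "norm (H t) = t powr a / Gamma (a + 1) * exp (- (\<epsilon> * t))" for t
      using Gap by (simp add: H_def norm_mult norm_divide s_def)
    have "((\<lambda>t. t powr a * exp (- (\<epsilon> * t))) \<longlongrightarrow> 0) (at_right 0)"
      using a by real_asymp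
    then have "((\<lambda>t. t powr a * exp (- (\<epsilon> * t)) / Gamma (a + 1)) \<longlongrightarrow> 0) (at_right 0)"
      by (rule tendsto_divide_zero)
    then have "((\<lambda>t. norm (H t)) \<longlongrightarrow> 0) (at_right 0)" by (simp add: nH)
    then show "((H \<circ> real_of_ereal) \<longlongrightarrow> 0) (at_right 0)"
      by (simp add: zero_ereal_def ereal_tendsto_simps tendsto_norm_zero_iff)
    have "((\<lambda>t. t powr a * exp (- (\<epsilon> * t))) \<longlongrightarrow> 0) at_top"
      using e a by real_asymp
    then have "((\<lambda>t. t powr a * exp (- (\<epsilon> * t)) / Gamma (a + 1)) \<longlongrightarrow> 0) at_top"
      by (rule tendsto_divide_zero)
    then have "((\<lambda>t. norm (H t)) \<longlongrightarrow> 0) at_top" by (simp add: nH)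
    then show "((H \<circ> real_of_ereal) \<longlongrightarrow> 0) (at_left \<infinity>)"
      by (simp add: ereal_tendsto_simps tendsto_norm_zero_iff)
  qed auto
  moreover have "(LBINT t=0..\<infinity>. f t) = (LINT t|lborel. f t)"
  proof -
    have "(LBINT t=0..\<infinity>. f t) = (LINT t|lborel. indicator {0<..} t *\<^sub>R f t)"
      by (simp add: interval_lebesgue_integral_def set_lebesgue_integral_def zero_ereal_def)
    also have "\<dots> = (LINT t|lborel. f t)"
      by (intro Bochner_Integration.integral_cong refl) (simp add: f_def gamma_density_def indicator_def)
    finally show ?thesis .
  qed
  moreover have "(LINT t|lborel. f t) = gamma_transform a \<epsilon> u - s * gamma_transform (a + 1) \<epsilon> u"
  proof -
    have "s * gamma_transform (a + 1) \<epsilon> u = (LINT t|lborel. s * (complex_of_real (gamma_density (a + 1) \<epsilon> t) * exp (- (\<i> * complex_of_real (u \<bullet> t)))))"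
      unfolding fourier_def by simp
    also have "gamma_transform a \<epsilon> u - \<dots> = (LINT t|lborel. f t)"
      unfolding fourier_def f_def left_diff_distrib mult.assoc
      by (rule Bochner_Integration.integral_diff[symmetric])
         (intro integrable_mult_character integrable_mult_right int)+
    finally show ?thesis ..
  qed
  ultimately show ?thesis by (simp add: s_def)
qed

text \<open>
  By the step formula the transform \<open>F\<close> satisfies the differential equation \<open>F' = - \<i> a F / (\<epsilon> + \<i> u)\<close>.
  Hence \<open>F u * (\<epsilon> + \<i> u) powr a\<close> is constant in \<open>u\<close>, and at \<open>u = 0\<close> it is given by the Gamma
  integral. The base \<open>\<epsilon> + \<i> u\<close> stays in the right half plane, so the principal branch is
  differentiable along the way.
\<close>

lemma gamma_transform_eq:
  assumes a: "a > 0" and e: "\<epsilon> > 0"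
  shows "gamma_transform a \<epsilon> u = (complex_of_real \<epsilon> + \<i> * complex_of_real u) powr complex_of_real (- a)"
proof -
  define s where "s = (\<lambda>u. complex_of_real \<epsilon> + \<i> * complex_of_real u)"
  have Re_s: "Re (s u) = \<epsilon>" for u by (simp add: s_def)
  have s_nz: "s u \<noteq> 0" for u using Re_s[of u] e by auto
  have s_dom: "s u \<notin> \<real>\<^sub>\<le>\<^sub>0" for u using Re_s[of u] e by (auto simp: complex_nonpos_Reals_iff)
  define G where "G = (\<lambda>u. gamma_transform a \<epsilon> u * s u powr complex_of_real a)"
  have "(G has_vector_derivative 0) (at u)" for u
  proof -
    have "(gamma_transform a \<epsilon> has_derivative
        (\<lambda>h. fourier (\<lambda>x. - (\<i> * complex_of_real (h \<bullet> x)) * complex_of_real (gamma_density a \<epsilon> x)) u)) (at u)"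
    proof (rule fourier_has_derivative)
      show "integrable lborel (\<lambda>t. complex_of_real (gamma_density a \<epsilon> t))"
        using assms by (intro integrable_of_real gamma_density_integrable)
      have "norm t * norm (complex_of_real (gamma_density a \<epsilon> t)) = a * gamma_density (a + 1) \<epsilon> t" for t
      proof -
        have "norm (complex_of_real (gamma_density a \<epsilon> t)) = gamma_density a \<epsilon> t"
          using gamma_density_nonneg[OF a, of \<epsilon> t] by simp
        moreover have "norm t * gamma_density a \<epsilon> t = t * gamma_density a \<epsilon> t"
          by (simp add: gamma_density_def)
        ultimately show ?thesis by (simp add: gamma_density_step[OF a])
      qed
      then show "integrable lborel (\<lambda>t. norm t * norm (complex_of_real (gamma_density a \<epsilon> t)))"
        using gamma_density_integrable[of "a + 1" \<epsilon>] assms by simp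
    qed
    moreover have "fourier (\<lambda>x. - (\<i> * complex_of_real (h \<bullet> x)) * complex_of_real (gamma_density a \<epsilon> x)) u
        = h *\<^sub>R (- \<i> * complex_of_real a * gamma_transform (a + 1) \<epsilon> u)" for h
    proof -
      have "fourier (\<lambda>x. - (\<i> * complex_of_real (h \<bullet> x)) * complex_of_real (gamma_density a \<epsilon> x)) u =
        (LINT t|lborel. (- \<i> * complex_of_real (h * a)) * (complex_of_real (gamma_density (a + 1) \<epsilon> t) * exp (- (\<i> * complex_of_real (u \<bullet> t)))))"
        unfolding fourier_def
      proof (intro Bochner_Integration.integral_cong refl)
        fix t
        have "complex_of_real t * complex_of_real (gamma_density a \<epsilon> t) = complex_of_real a * complex_of_real (gamma_density (a + 1) \<epsilon> t)"
          using gamma_density_step[OF a, of t \<epsilon>] by (simp flip: of_real_mult)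
        then show "- (\<i> * complex_of_real (h \<bullet> t)) * complex_of_real (gamma_density a \<epsilon> t) * exp (- (\<i> * complex_of_real (u \<bullet> t))) =
          (- \<i> * complex_of_real (h * a)) * (complex_of_real (gamma_density (a + 1) \<epsilon> t) * exp (- (\<i> * complex_of_real (u \<bullet> t))))"
          by (simp add: mult_ac)
      qed
      then show ?thesis by (simp add: fourier_def scaleR_conv_of_real mult_ac)
    qed
    ultimately have 1: "(gamma_transform a \<epsilon> has_vector_derivative (- \<i> * complex_of_real a * gamma_transform (a + 1) \<epsilon> u)) (at u)"
      unfolding has_vector_derivative_def by simp
    have "((\<lambda>z. z powr complex_of_real a) has_field_derivative complex_of_real a * s u powr (complex_of_real a - 1)) (at (s u))"
      by (rule has_field_derivative_powr[OF s_dom])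
    moreover have "(s has_vector_derivative \<i>) (at u)"
      unfolding s_def by (auto intro!: derivative_eq_intros)
    ultimately have 2: "((\<lambda>u. s u powr complex_of_real a) has_vector_derivative \<i> * (complex_of_real a * s u powr (complex_of_real a - 1))) (at u)"
      using field_vector_diff_chain_at[of s \<i> u "\<lambda>z. z powr complex_of_real a"] by (simp add: o_def)
    have "s u powr (complex_of_real a - 1) = s u powr complex_of_real a / s u"
      using s_nz[of u] by (simp add: powr_diff)
    moreover have "gamma_transform (a + 1) \<epsilon> u = gamma_transform a \<epsilon> u / s u"
      using gamma_transform_step[OF a e, of u] s_nz[of u] by (simp add: s_def field_simps)
    ultimately show ?thesis
      unfolding G_def using has_vector_derivative_mult[OF 1 2] by (simp add: algebra_simps)
  qed
  then obtain c where c: "\<And>u. G u = c"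
    using has_vector_derivative_zero_constant[of UNIV G] by auto
  have "gamma_transform a \<epsilon> 0 = complex_of_real (\<epsilon> powr - a)"
    using gamma_density_integral[OF assms] by (simp add: fourier_def)
  then have "G 0 = 1"
    using e by (simp add: G_def s_def powr_of_real[symmetric] powr_minus)
  then have "gamma_transform a \<epsilon> u * s u powr complex_of_real a = 1"
    using c[of 0] c[of u] by (simp add: G_def)
  then show ?thesis
    using s_nz[of u] by (simp add: s_def powr_minus field_simps)
qed

section \<open>Fourier inversion on the Schwartz space\<close>

lemma character_eq_prod_Basis:
  fixes x y :: "'a::euclidean_space"
  shows "exp (- (\<i> * complex_of_real (y \<bullet> x))) = (\<Prod>b\<in>Basis. exp (- (\<i> * complex_of_real ((y \<bullet> b) \<bullet> (x \<bullet> b)))))"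
proof -
  have "- (\<i> * complex_of_real (y \<bullet> x)) = (\<Sum>b\<in>Basis. - (\<i> * complex_of_real ((y \<bullet> b) \<bullet> (x \<bullet> b))))"
    by (subst euclidean_inner) (simp add: sum_distrib_left sum_negf)
  then show ?thesis by (simp only: exp_sum[OF finite_Basis])
qed

lemma fourier_prod_Basis:
  fixes f :: "'a::euclidean_space \<Rightarrow> real \<Rightarrow> complex"
  assumes "\<And>b. b \<in> Basis \<Longrightarrow> integrable lborel (f b)"
  shows "fourier (\<lambda>x::'a. \<Prod>b\<in>Basis. f b (x \<bullet> b)) y = (\<Prod>b\<in>Basis. fourier (f b) (y \<bullet> b))"
proof -
  have "fourier (\<lambda>x::'a. \<Prod>b\<in>Basis. f b (x \<bullet> b)) y =
      (LINT x|lborel. (\<Prod>b\<in>Basis. f b (x \<bullet> b) * exp (- (\<i> * complex_of_real ((y \<bullet> b) \<bullet> (x \<bullet> b))))))"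
    unfolding fourier_def character_eq_prod_Basis[of y] by (simp only: prod.distrib)
  also have "\<dots> = (\<Prod>b\<in>Basis. fourier (f b) (y \<bullet> b))"
    unfolding fourier_def
    by (rule lborel_prod_Basis(2)[where f="\<lambda>b t. f b t * exp (- (\<i> * complex_of_real ((y \<bullet> b) \<bullet> t)))"])
       (rule integrable_mult_character[OF assms])
  finally show ?thesis .
qed

text \<open>
  Up to the null set \<open>{0}\<close>, \<open>exp (- \<epsilon> \<bar>t\<bar>)\<close> is the gamma density with \<open>a = 1\<close> plus its reflection, so
  its transform is \<open>1 / (\<epsilon> + \<i> u) + 1 / (\<epsilon> - \<i> u)\<close>.
\<close>

lemma fourier_exp_abs:
  assumes e: "\<epsilon> > 0"
  shows "integrable lborel (\<lambda>t::real. complex_of_real (exp (- (\<epsilon> * \<bar>t\<bar>))))"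
    and "fourier (\<lambda>t::real. complex_of_real (exp (- (\<epsilon> * \<bar>t\<bar>)))) u = complex_of_real (2 * \<epsilon> / (\<epsilon>\<^sup>2 + u\<^sup>2))"
proof -
  let ?g = "\<lambda>t. complex_of_real (gamma_density 1 \<epsilon> t)"
  have g: "integrable lborel ?g"
    using e by (intro integrable_of_real gamma_density_integrable) auto
  have g': "integrable lborel (\<lambda>t. ?g (- t))"
    using lborel_integrable_real_affine[OF g, of "-1" 0] by simp
  have ae: "AE t::real in lborel. complex_of_real (exp (- (\<epsilon> * \<bar>t\<bar>))) = ?g t + ?g (- t)"
    by (rule AE_mp[OF AE_lborel_singleton[of 0]]) (auto intro!: AE_I2 simp: gamma_density_def powr_zero_eq_one)
  show "integrable lborel (\<lambda>t::real. complex_of_real (exp (- (\<epsilon> * \<bar>t\<bar>))))"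
    by (rule integrable_cong_AE_imp[OF Bochner_Integration.integrable_add[OF g g']])
       (use ae in \<open>auto simp: eq_commute\<close>)
  have "fourier (\<lambda>t::real. complex_of_real (exp (- (\<epsilon> * \<bar>t\<bar>)))) u = fourier (\<lambda>t. ?g t + ?g (- t)) u"
    unfolding fourier_def by (rule integral_cong_AE) (use ae in auto)
  also have "\<dots> = fourier ?g u + fourier (\<lambda>t. ?g (- t)) u"
    unfolding fourier_def distrib_right
    by (rule Bochner_Integration.integral_add[OF integrable_mult_character[OF g] integrable_mult_character[OF g']])
  also have "fourier (\<lambda>t. ?g (- t)) u = fourier ?g (- u)"
    unfolding fourier_def
    using lborel_integral_real_affine[of "-1" "\<lambda>t. ?g t * exp (- (\<i> * complex_of_real (- u \<bullet> t)))" 0] by simp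
  also have "fourier ?g u + fourier ?g (- u) = complex_of_real (2 * \<epsilon> / (\<epsilon>\<^sup>2 + u\<^sup>2))"
  proof -
    let ?s = "complex_of_real \<epsilon> + \<i> * complex_of_real u"
    let ?s' = "complex_of_real \<epsilon> - \<i> * complex_of_real u"
    have "Re ?s = \<epsilon>" "Re ?s' = \<epsilon>" by simp_all
    then have nz: "?s \<noteq> 0" "?s' \<noteq> 0" using e by (metis less_irrefl zero_complex.sel(1))+
    have "fourier ?g u = inverse ?s" "fourier ?g (- u) = inverse ?s'"
      using gamma_transform_eq[of 1 \<epsilon> u] gamma_transform_eq[of 1 \<epsilon> "-u"] e nz by (simp_all add: powr_minus)
    moreover have "inverse ?s + inverse ?s' = 2 * complex_of_real \<epsilon> / (?s * ?s')"
      using nz by (simp add: field_simps)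
    moreover have "?s * ?s' = complex_of_real (\<epsilon>\<^sup>2 + u\<^sup>2)"
      by (simp add: algebra_simps power2_eq_square)
    ultimately show ?thesis by simp
  qed
  finally show "fourier (\<lambda>t::real. complex_of_real (exp (- (\<epsilon> * \<bar>t\<bar>)))) u = complex_of_real (2 * \<epsilon> / (\<epsilon>\<^sup>2 + u\<^sup>2))" .
qed

lemma integral_lborel_affine:
  fixes f :: "'a::euclidean_space \<Rightarrow> complex"
  assumes [measurable]: "f \<in> borel_measurable borel" and c: "c > 0"
  shows "(LINT y|lborel. f y) = complex_of_real (c ^ DIM('a)) * (LINT v|lborel. f (t + c *\<^sub>R v))"
proof -
  have "(LINT y|lborel. f y) = (LINT y|density (distr lborel borel (\<lambda>x. t + c *\<^sub>R x)) (\<lambda>_. ennreal (\<bar>c\<bar>^DIM('a))). f y)"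
    using lborel_affine[of c t] c by simp
  also have "\<dots> = (LINT y|distr lborel borel (\<lambda>x. t + c *\<^sub>R x). \<bar>c\<bar>^DIM('a) *\<^sub>R f y)"
    by (rule integral_density) auto
  also have "\<dots> = (LINT v|lborel. \<bar>c\<bar>^DIM('a) *\<^sub>R f (t + c *\<^sub>R v))"
    by (rule integral_distr) auto
  finally show ?thesis using c by (simp add: scaleR_conv_of_real)
qed

text \<open>
  The outer integral is regularised by the factor \<open>\<Prod>b. exp (- h \<bar>\<omega> \<bullet> b\<bar>)\<close>, whose transform is a product
  of Poisson kernels of width \<open>h\<close>. The multiplication formula turns the regularised integral into
  an average of \<open>f\<close> around \<open>- x\<close> against these kernels, and \<open>h\<close> tends to 0 on both sides.
\<close>

theorem fourier_fourier:
  fixes f :: "'a::euclidean_space \<Rightarrow> complex"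
  assumes f: "schwartz f"
  shows "fourier (fourier f) x = complex_of_real ((2 * pi) ^ DIM('a)) * f (- x)"
proof -
  define h where "h = (\<lambda>n. 1 / real (Suc n))"
  have h: "h n > 0" for n by (auto simp: h_def)
  have h0: "h \<longlonglongrightarrow> 0" unfolding h_def by (rule LIMSEQ_inverse_real_of_nat[unfolded inverse_eq_divide])
  define m where "m = (\<lambda>n (\<omega>::'a). \<Prod>b\<in>Basis. complex_of_real (exp (- (h n * \<bar>\<omega> \<bullet> b\<bar>))))"
  define P where "P = (\<lambda>v::'a. \<Prod>b\<in>Basis. complex_of_real (2 / (1 + (v \<bullet> b)\<^sup>2)))"
  have fm[measurable]: "f \<in> borel_measurable borel" using f by (rule schwartz_measurable)
  have Ff: "integrable lborel (fourier f)"
    using schwartz_integrable[OF schwartz_fourier[OF f]] .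
  have Fm[measurable]: "fourier f \<in> borel_measurable borel"
    using borel_measurable_integrable[OF Ff] by simp
  have mm[measurable]: "m n \<in> borel_measurable borel" for n unfolding m_def by measurable
  have m_int: "integrable lborel (m n)" for n
    unfolding m_def using fourier_exp_abs(1)[OF h] by (rule lborel_prod_Basis(1))
  have P_int: "integrable lborel P" and P_eq: "(LINT v|lborel. P v) = complex_of_real ((2 * pi) ^ DIM('a))"
  proof -
    have i1: "integrable lborel (\<lambda>t::real. complex_of_real (2 / (1 + t\<^sup>2)))"
      using integrable_mult_right[OF integrable_inverse_1_plus_square_lborel, of 2]
      by (intro integrable_of_real) simp
    have i2: "(LINT t|lborel. complex_of_real (2 / (1 + t\<^sup>2))) = complex_of_real (2 * pi)"
    proof -
      have "(LINT t|lborel. 2 / (1 + t\<^sup>2) :: real) = 2 * (LINT t|lborel. 1 / (1 + t\<^sup>2))"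
        unfolding integral_mult_right_zero[symmetric] by simp
      then show ?thesis
        unfolding integral_complex_of_real integral_inverse_1_plus_square_lborel by simp
    qed
    show "integrable lborel P"
      unfolding P_def using i1 by (rule lborel_prod_Basis(1))
    have "(LINT v|lborel. P v) = (\<Prod>b\<in>(Basis :: 'a set). LINT t|lborel. complex_of_real (2 / (1 + t\<^sup>2)))"
      unfolding P_def using i1 by (rule lborel_prod_Basis(2))
    then show "(LINT v|lborel. P v) = complex_of_real ((2 * pi) ^ DIM('a))"
      by (simp only: i2 prod_constant of_real_power)
  qed
  have Pm[measurable]: "P \<in> borel_measurable borel" using borel_measurable_integrable[OF P_int] by simp
  have Fourier_m: "fourier (m n) y = (\<Prod>b\<in>Basis. complex_of_real (2 * h n / ((h n)\<^sup>2 + (y \<bullet> b)\<^sup>2)))" for n y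
    unfolding m_def
    by (subst fourier_prod_Basis[where f="\<lambda>b t. complex_of_real (exp (- (h n * \<bar>t\<bar>)))"])
       (simp_all only: fourier_exp_abs[OF h])
  have regularized: "(LINT \<omega>|lborel. fourier f \<omega> * (m n \<omega> * exp (- (\<i> * complex_of_real (x \<bullet> \<omega>))))) =
      (LINT v|lborel. f (- x + h n *\<^sub>R v) * P v)" for n
  proof -
    have "(LINT \<omega>|lborel. fourier f \<omega> * (m n \<omega> * exp (- (\<i> * complex_of_real (x \<bullet> \<omega>))))) =
        (LINT y|lborel. f y * fourier (\<lambda>\<omega>. m n \<omega> * exp (- (\<i> * complex_of_real (x \<bullet> \<omega>)))) y)"
      by (rule fourier_multiplication_formula[OF schwartz_integrable[OF f] integrable_mult_character[OF m_int]])
    also have "\<dots> = (LINT y|lborel. f y * (\<Prod>b\<in>Basis. complex_of_real (2 * h n / ((h n)\<^sup>2 + ((x + y) \<bullet> b)\<^sup>2))))"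
    proof -
      have "fourier (\<lambda>\<omega>. m n \<omega> * exp (- (\<i> * complex_of_real (x \<bullet> \<omega>)))) y = fourier (m n) (x + y)" for y
        unfolding fourier_def
        by (intro Bochner_Integration.integral_cong refl)
           (simp add: inner_add_left algebra_simps flip: exp_add)
      then show ?thesis unfolding Fourier_m by simp
    qed
    \<comment> \<open>The substitution \<open>y = - x + h v\<close> rescales the Poisson kernels to width 1.\<close>
    also have "\<dots> = complex_of_real (h n ^ DIM('a)) * (LINT v|lborel. f (- x + h n *\<^sub>R v) * (\<Prod>b\<in>Basis. complex_of_real (2 * h n / ((h n)\<^sup>2 + ((x + (- x + h n *\<^sub>R v)) \<bullet> b)\<^sup>2))))"
      by (rule integral_lborel_affine[OF _ h]) measurable
    also have "\<dots> = (LINT v|lborel. f (- x + h n *\<^sub>R v) * P v)"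
      unfolding integral_mult_right_zero[symmetric]
    proof (intro Bochner_Integration.integral_cong refl)
      fix v :: 'a
      have scale: "(x + (- x + h n *\<^sub>R v)) \<bullet> b = h n * (v \<bullet> b)" for b
        by (simp only: add_minus_cancel inner_scaleR_left)
      have "complex_of_real (h n ^ DIM('a)) * (\<Prod>b\<in>Basis. complex_of_real (2 * h n / ((h n)\<^sup>2 + ((x + (- x + h n *\<^sub>R v)) \<bullet> b)\<^sup>2))) =
        (\<Prod>b\<in>(Basis::'a set). complex_of_real (h n) * complex_of_real (2 * h n / ((h n)\<^sup>2 + (h n * (v \<bullet> b))\<^sup>2)))"
        by (simp only: scale prod.distrib prod_constant of_real_power)
      also have "\<dots> = P v"
        unfolding P_def
      proof (intro prod.cong refl)
        fix b :: 'a
        have "(h n)\<^sup>2 + (h n * (v \<bullet> b))\<^sup>2 = (h n)\<^sup>2 * (1 + (v \<bullet> b)\<^sup>2)"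
          by (simp add: algebra_simps power2_eq_square)
        then have "h n * (2 * h n / ((h n)\<^sup>2 + (h n * (v \<bullet> b))\<^sup>2)) = 2 / (1 + (v \<bullet> b)\<^sup>2)"
          using h[of n] by (simp add: power2_eq_square)
        then show "complex_of_real (h n) * complex_of_real (2 * h n / ((h n)\<^sup>2 + (h n * (v \<bullet> b))\<^sup>2)) = complex_of_real (2 / (1 + (v \<bullet> b)\<^sup>2))"
          by (simp only: of_real_mult[symmetric])
      qed
      finally have prod_P: "complex_of_real (h n ^ DIM('a)) * (\<Prod>b\<in>Basis. complex_of_real (2 * h n / ((h n)\<^sup>2 + ((x + (- x + h n *\<^sub>R v)) \<bullet> b)\<^sup>2))) = P v" .
      show "complex_of_real (h n ^ DIM('a)) * (f (- x + h n *\<^sub>R v) * (\<Prod>b\<in>Basis. complex_of_real (2 * h n / ((h n)\<^sup>2 + ((x + (- x + h n *\<^sub>R v)) \<bullet> b)\<^sup>2)))) =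
        f (- x + h n *\<^sub>R v) * P v"
        by (subst mult.left_commute) (simp only: prod_P)
    qed
    finally show ?thesis .
  qed
  have lim1: "(\<lambda>n. LINT \<omega>|lborel. fourier f \<omega> * (m n \<omega> * exp (- (\<i> * complex_of_real (x \<bullet> \<omega>))))) \<longlonglongrightarrow> fourier (fourier f) x"
    unfolding fourier_def[of "fourier f" x]
  proof (rule integral_dominated_convergence[where w="\<lambda>\<omega>. norm (fourier f \<omega>)"])
    show "integrable lborel (\<lambda>\<omega>. norm (fourier f \<omega>))" using Ff by (rule integrable_norm)
    show "AE \<omega> in lborel. (\<lambda>n. fourier f \<omega> * (m n \<omega> * exp (- (\<i> * complex_of_real (x \<bullet> \<omega>))))) \<longlonglongrightarrow> fourier f \<omega> * exp (- (\<i> * complex_of_real (x \<bullet> \<omega>)))"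
    proof (rule AE_I2)
      fix \<omega> :: 'a
      have "(\<lambda>n. m n \<omega>) \<longlonglongrightarrow> (\<Prod>b\<in>(Basis::'a set). complex_of_real (exp (- (0 * \<bar>\<omega> \<bullet> b\<bar>))))"
        unfolding m_def by (intro tendsto_intros h0)
      then have "(\<lambda>n. m n \<omega>) \<longlonglongrightarrow> 1" by simp
      from tendsto_mult[OF tendsto_const tendsto_mult[OF this tendsto_const]]
      show "(\<lambda>n. fourier f \<omega> * (m n \<omega> * exp (- (\<i> * complex_of_real (x \<bullet> \<omega>))))) \<longlonglongrightarrow> fourier f \<omega> * exp (- (\<i> * complex_of_real (x \<bullet> \<omega>)))"
        by simp
    qed
    show "AE \<omega> in lborel. norm (fourier f \<omega> * (m n \<omega> * exp (- (\<i> * complex_of_real (x \<bullet> \<omega>))))) \<le> norm (fourier f \<omega>)" for n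
    proof (rule AE_I2)
      fix \<omega> :: 'a
      have "norm (m n \<omega>) \<le> 1"
        unfolding m_def prod_norm[symmetric] using h[of n] by (intro prod_le_1) auto
      then show "norm (fourier f \<omega> * (m n \<omega> * exp (- (\<i> * complex_of_real (x \<bullet> \<omega>))))) \<le> norm (fourier f \<omega>)"
        by (simp add: norm_mult mult_left_le)
    qed
  qed measurable
  have lim2: "(\<lambda>n. LINT v|lborel. f (- x + h n *\<^sub>R v) * P v) \<longlonglongrightarrow> (LINT v|lborel. f (- x) * P v)"
  proof -
    obtain C where C: "C \<ge> 0" "\<And>x. norm (f x) \<le> C * (1 / (1 + norm x) ^ 0)"
      using rapidly_decreasing_decay[OF schwartz_rapidly_decreasing[OF f], where N=0] by metis
    show ?thesis
    proof (rule integral_dominated_convergence[where w="\<lambda>v. C * norm (P v)"])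
      show "integrable lborel (\<lambda>v. C * norm (P v))" using P_int by simp
      show "AE v in lborel. (\<lambda>n. f (- x + h n *\<^sub>R v) * P v) \<longlonglongrightarrow> f (- x) * P v"
      proof (rule AE_I2)
        fix v :: 'a
        have "(\<lambda>n. - x + h n *\<^sub>R v) \<longlonglongrightarrow> - x + 0 *\<^sub>R v" by (intro tendsto_intros h0)
        then have "(\<lambda>n. f (- x + h n *\<^sub>R v)) \<longlonglongrightarrow> f (- x)"
          using schwartz_continuous[OF f, of UNIV] by (intro continuous_on_tendsto_compose[where s=UNIV and f=f]) auto
        then show "(\<lambda>n. f (- x + h n *\<^sub>R v) * P v) \<longlonglongrightarrow> f (- x) * P v" by (intro tendsto_intros)
      qed
      show "AE v in lborel. norm (f (- x + h n *\<^sub>R v) * P v) \<le> C * norm (P v)" for n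
        using C(2) by (auto intro!: AE_I2 mult_right_mono simp: norm_mult)
    qed measurable
  qed
  have "fourier (fourier f) x = (LINT v|lborel. f (- x) * P v)"
    using LIMSEQ_unique[OF lim1[unfolded regularized] lim2] .
  also have "\<dots> = complex_of_real ((2 * pi) ^ DIM('a)) * f (- x)"
    using P_eq by (simp add: mult.commute)
  finally show ?thesis .
qed

text \<open>
  Applying the Fourier transform four times multiplies by a nonzero constant, so the preimage of \<open>f\<close> is a
  multiple of the threefold transform.
\<close>

corollary fourier_surj_schwartz:
  fixes f :: "'a::euclidean_space \<Rightarrow> complex"
  assumes f: "schwartz f"
  obtains g where "schwartz g" "fourier g = f"
proof -
  define c where "c = complex_of_real ((2 * pi) ^ DIM('a))"
  have c: "c \<noteq> 0" by (simp add: c_def)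
  have twice: "fourier (fourier h) x = c * h (- x)" if "schwartz h" for h :: "'a \<Rightarrow> complex" and x
    unfolding c_def using that by (rule fourier_fourier)
  define g where "g = (\<lambda>x. (1 / c\<^sup>2) * fourier (fourier (fourier f)) x)"
  have "schwartz g"
    unfolding g_def using f by (intro schwartz_cmult schwartz_fourier)
  moreover have "fourier g = f"
  proof
    fix x
    have "fourier g x = (1 / c\<^sup>2) * fourier (fourier (fourier (fourier f))) x"
      unfolding g_def fourier_def[of _ x] integral_mult_right_zero[symmetric] by (simp add: mult.assoc)
    also have "\<dots> = f x"
      unfolding twice[OF schwartz_fourier[OF schwartz_fourier[OF f]]] twice[OF f]
      using c by (simp add: power2_eq_square)
    finally show "fourier g x = f x" .
  qed
  ultimately show ?thesis using that by blast
qed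

section \<open>Products over a dual basis\<close>

lemma Basis_vec_eq_range: "(Basis :: (real ^ 'n) set) = range (\<lambda>k. axis k 1)"
  by (auto simp: Basis_vec_def)

lemma prod_Basis_vec:
  "(\<Prod>b\<in>(Basis :: (real ^ 'n) set). g b) = (\<Prod>k\<in>UNIV. g (axis k 1))"
  for g :: "real ^ 'n \<Rightarrow> 'b::comm_monoid_mult"
  unfolding Basis_vec_eq_range
  by (subst prod.reindex) (auto simp: inj_def axis_eq_axis o_def)

text \<open>
  In the coordinates \<open>t = (x \<bullet> Xd k)\<^sub>k\<close>, that is \<open>x = \<Sum>k. t k *\<^sub>R X k\<close>, the character
  \<open>exp (- \<i> (\<omega> \<bullet> x))\<close> factors into the characters of frequency \<open>\<omega> \<bullet> X k\<close>. The constant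
  \<open>\<kappa>\<close> is the inverse modulus of the Jacobian determinant of the map from \<open>t\<close> to \<open>x\<close>. That one constant serves all \<open>f\<close> is
  essential: it makes the normalisations of the cone splines for different exponents agree.
\<close>

lemma fourier_dual_basis_product:
  fixes X Xd :: "'n::finite \<Rightarrow> real ^ 'n"
  assumes dual: "\<And>j k. X j \<bullet> Xd k = (if j = k then 1 else 0)"
  shows "\<exists>\<kappa>>0. \<forall>f :: 'n \<Rightarrow> real \<Rightarrow> complex. (\<forall>k. integrable lborel (f k)) \<longrightarrow>
    integrable lborel (\<lambda>x. \<Prod>k\<in>UNIV. f k (x \<bullet> Xd k)) \<and>
    (\<forall>\<omega>. fourier (\<lambda>x. complex_of_real \<kappa> * (\<Prod>k\<in>UNIV. f k (x \<bullet> Xd k))) \<omega> = (\<Prod>k\<in>UNIV. fourier (f k) (\<omega> \<bullet> X k)))"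
proof -
  define T where "T = (\<lambda>t :: real ^ 'n. \<Sum>k\<in>UNIV. (t $ k) *\<^sub>R X k)"
  define S where "S = (\<lambda>x :: real ^ 'n. \<chi> k. x \<bullet> Xd k)"
  have T: "linear T"
    by (rule linearI) (simp_all add: T_def scaleR_left_distrib sum.distrib scaleR_sum_right)
  have T_coord: "T t \<bullet> Xd k = t $ k" for t k
    by (simp add: T_def inner_sum_left dual if_distrib[of "(*) _"] sum.delta cong: if_cong)
  then have ST: "S (T t) = t" for t by (simp add: S_def vec_eq_iff)
  then have "inj T" by (metis injI)
  then have "surj T" using linear_injective_imp_surjective[OF T] by blast
  then have TS: "T (S x) = x" for x using ST by (metis surjD)
  obtain c where c: "c > 0" and distr: "distr lborel borel T = density lborel (\<lambda>_. ennreal c)"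
    using lborel_linear_image[OF T TS] by blast
  have Tm[measurable]: "T \<in> borel_measurable borel"
    using T by (intro borel_measurable_continuous_onI linear_continuous_on) (simp add: linear_conv_bounded_linear)
  have change_int: "integrable lborel g \<longleftrightarrow> integrable lborel (\<lambda>t. g (T t))"
    if [measurable]: "g \<in> borel_measurable borel" for g :: "real ^ 'n \<Rightarrow> complex"
  proof -
    have "integrable lborel (\<lambda>t. g (T t)) \<longleftrightarrow> integrable (distr lborel borel T) g"
      by (subst integrable_distr_eq) auto
    also have "\<dots> \<longleftrightarrow> integrable lborel g"
    proof
      assume "integrable (distr lborel borel T) g"
      then have "integrable lborel (\<lambda>x. c *\<^sub>R g x)"
        unfolding distr using c by (subst (asm) integrable_density) auto
      from integrable_scaleR_right[OF this, of "1 / c"] show "integrable lborel g"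
        using c by simp
    next
      assume "integrable lborel g"
      then show "integrable (distr lborel borel T) g"
        unfolding distr using c by (subst integrable_density) auto
    qed
    finally show ?thesis ..
  qed
  have change: "complex_of_real c * (LINT x|lborel. g x) = (LINT t|lborel. g (T t))"
    if [measurable]: "g \<in> borel_measurable borel" for g :: "real ^ 'n \<Rightarrow> complex"
  proof -
    have "(LINT t|lborel. g (T t)) = (LINT x|distr lborel borel T. g x)"
      by (subst integral_distr) auto
    also have "\<dots> = complex_of_real c * (LINT x|lborel. g x)"
      unfolding distr using c by (subst integral_density) (auto simp: scaleR_conv_of_real)
    finally show ?thesis ..
  qed
  define \<kappa> where "\<kappa> = c"
  define ix where "ix = inv (\<lambda>k::'n. axis k (1::real))"
  have ix: "ix (axis k 1) = k" for k
    unfolding ix_def by (rule inv_f_f) (auto simp: inj_def axis_eq_axis)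
  have prod_eq: "(\<Prod>k\<in>UNIV. f k (T t \<bullet> Xd k)) = (\<Prod>b\<in>Basis. f (ix b) (t \<bullet> b))"
    for f :: "'n \<Rightarrow> real \<Rightarrow> complex" and t
    by (simp add: prod_Basis_vec T_coord ix inner_axis)
  show ?thesis
  proof (intro exI[of _ \<kappa>] conjI allI impI)
    show "\<kappa> > 0" using c by (simp add: \<kappa>_def)
  next
    fix f :: "'n \<Rightarrow> real \<Rightarrow> complex" assume "\<forall>k. integrable lborel (f k)"
    then have f: "integrable lborel (f k)" for k by blast
    have [measurable]: "f k \<in> borel_measurable borel" for k using borel_measurable_integrable[OF f[of k]] by simp
    show "integrable lborel (\<lambda>x. \<Prod>k\<in>UNIV. f k (x \<bullet> Xd k))"
      by (subst change_int, measurable, subst prod_eq, rule lborel_prod_Basis(1)) (rule f)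
  next
    fix f :: "'n \<Rightarrow> real \<Rightarrow> complex" and \<omega> assume "\<forall>k. integrable lborel (f k)"
    then have f: "integrable lborel (f k)" for k by blast
    have [measurable]: "f k \<in> borel_measurable borel" for k using borel_measurable_integrable[OF f[of k]] by simp
    define y where "y = (\<chi> k. \<omega> \<bullet> X k)"
    have inner: "\<omega> \<bullet> T t = y \<bullet> t" for t
      unfolding inner_vec_def[of y] by (simp add: T_def y_def inner_sum_right mult.commute)
    have "fourier (\<lambda>x. complex_of_real \<kappa> * (\<Prod>k\<in>UNIV. f k (x \<bullet> Xd k))) \<omega> =
        complex_of_real c * (LINT x|lborel. (\<Prod>k\<in>UNIV. f k (x \<bullet> Xd k)) * exp (- (\<i> * complex_of_real (\<omega> \<bullet> x))))"
      by (simp add: fourier_def \<kappa>_def mult.assoc)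
    also have "\<dots> = (LINT t|lborel. (\<Prod>k\<in>UNIV. f k (T t \<bullet> Xd k)) * exp (- (\<i> * complex_of_real (\<omega> \<bullet> T t))))"
      by (rule change) measurable
    also have "\<dots> = fourier (\<lambda>t. \<Prod>b\<in>Basis. f (ix b) (t \<bullet> b)) y"
      by (simp only: prod_eq inner fourier_def)
    also have "\<dots> = (\<Prod>b\<in>Basis. fourier (f (ix b)) (y \<bullet> b))"
      by (rule fourier_prod_Basis) (rule f)
    also have "\<dots> = (\<Prod>k\<in>UNIV. fourier (f k) (\<omega> \<bullet> X k))"
      by (simp add: prod_Basis_vec ix inner_axis y_def)
    finally show "fourier (\<lambda>x. complex_of_real \<kappa> * (\<Prod>k\<in>UNIV. f k (x \<bullet> Xd k))) \<omega> = (\<Prod>k\<in>UNIV. fourier (f k) (\<omega> \<bullet> X k))" .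
  qed
qed

section \<open>Tempered distributions given by functions\<close>

lemma schwartz_seminorm_bound:
  fixes \<phi> :: "'a::euclidean_space \<Rightarrow> complex"
  assumes "schwartz \<phi>"
  shows "(1 + norm x) ^ N * norm (\<phi> x) \<le> schwartz_seminorm N \<phi>"
proof -
  let ?B = "{bs :: 'a list. set bs \<subseteq> Basis \<and> length bs \<le> N}"
  let ?s = "\<lambda>bs. SUP x. (1 + norm x) ^ N * norm (iter_deriv bs \<phi> x)"
  have fin: "finite ?B" by (rule finite_lists_length_le) simp
  have le: "(1 + norm x) ^ N * norm (iter_deriv bs \<phi> x) \<le> ?s bs" if "bs \<in> ?B" for bs x
    using that assms by (intro cSUP_upper bounded_imp_bdd_above) (auto simp: schwartz_def)
  have "0 \<le> ?s bs" if "bs \<in> ?B" for bs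
    using le[OF that, of 0] by (rule order_trans[rotated]) auto
  then have "?s [] \<le> schwartz_seminorm N \<phi>"
    unfolding schwartz_seminorm_def using fin by (intro member_le_sum[of "[]" ?B ?s]) auto
  moreover have "(1 + norm x) ^ N * norm (\<phi> x) \<le> ?s []"
    using le[of "[]" x] by (simp add: iter_deriv_def)
  ultimately show ?thesis by linarith
qed

lemma moderate_growth_integrable:
  fixes f :: "'a::euclidean_space \<Rightarrow> complex"
  assumes f: "f \<in> borel_measurable borel" and int: "integrable lborel (\<lambda>x. norm (f x) / (1 + norm x) ^ N)"
    and \<phi>: "schwartz \<phi>"
  shows "integrable lborel (\<lambda>x. f x * \<phi> x)"
    and "norm (LINT x|lborel. f x * \<phi> x) \<le> (LINT x|lborel. norm (f x) / (1 + norm x) ^ N) * schwartz_seminorm N \<phi>"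
proof -
  have [measurable]: "f \<in> borel_measurable borel" "\<phi> \<in> borel_measurable borel"
    using f schwartz_measurable[OF \<phi>] by auto
  have bound: "norm (f x * \<phi> x) \<le> norm (f x) / (1 + norm x) ^ N * schwartz_seminorm N \<phi>" for x
  proof -
    have pos: "(1 + norm x) ^ N > 0" by (intro zero_less_power add_pos_nonneg) auto
    have "norm (f x * \<phi> x) = norm (f x) / (1 + norm x) ^ N * ((1 + norm x) ^ N * norm (\<phi> x))"
      using less_imp_neq[OF pos] by (simp add: norm_mult del: power_eq_0_iff)
    also have "\<dots> \<le> norm (f x) / (1 + norm x) ^ N * schwartz_seminorm N \<phi>"
      using pos by (intro mult_left_mono schwartz_seminorm_bound[OF \<phi>]) auto
    finally show ?thesis .
  qed
  show i: "integrable lborel (\<lambda>x. f x * \<phi> x)"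
  proof (rule Bochner_Integration.integrable_bound)
    show "integrable lborel (\<lambda>x. norm (f x) / (1 + norm x) ^ N * schwartz_seminorm N \<phi>)"
      by (rule integrable_mult_left[OF int])
    show "AE x in lborel. norm (f x * \<phi> x) \<le> norm (norm (f x) / (1 + norm x) ^ N * schwartz_seminorm N \<phi>)"
      by (intro AE_I2) (unfold real_norm_def, rule order_trans[OF bound abs_ge_self])
  qed measurable
  have "norm (LINT x|lborel. f x * \<phi> x) \<le> (LINT x|lborel. norm (f x * \<phi> x))"
    by (rule integral_norm_bound)
  also have "\<dots> \<le> (LINT x|lborel. norm (f x) / (1 + norm x) ^ N * schwartz_seminorm N \<phi>)"
    by (intro integral_mono bound integrable_norm integrable_mult_left i int)
  finally show "norm (LINT x|lborel. f x * \<phi> x) \<le> (LINT x|lborel. norm (f x) / (1 + norm x) ^ N) * schwartz_seminorm N \<phi>"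
    by (simp only: integral_mult_left_zero)
qed

text \<open>
  The factor \<open>(1 + norm x) ^ N\<close> is moved from \<open>f\<close> onto the test function, where the seminorm of
  order \<open>N\<close> controls it.
\<close>

lemma tempered_dist_of_fun:
  fixes f :: "'a::euclidean_space \<Rightarrow> complex"
  assumes f: "f \<in> borel_measurable borel" and int: "integrable lborel (\<lambda>x. norm (f x) / (1 + norm x) ^ N)"
  shows "tempered (dist_of_fun f)"
  unfolding tempered_def
proof (intro conjI allI impI)
  fix \<phi> \<psi> :: "'a \<Rightarrow> complex" assume s: "schwartz \<phi>" "schwartz \<psi>"
  have "(LINT x|lborel. f x * (\<phi> x + \<psi> x)) = (LINT x|lborel. f x * \<phi> x + f x * \<psi> x)"
    by (simp add: distrib_left)
  also have "\<dots> = (LINT x|lborel. f x * \<phi> x) + (LINT x|lborel. f x * \<psi> x)"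
    by (intro Bochner_Integration.integral_add moderate_growth_integrable(1)[OF f int] s)
  finally show "dist_of_fun f (\<lambda>x. \<phi> x + \<psi> x) = dist_of_fun f \<phi> + dist_of_fun f \<psi>"
    using s schwartz_add[OF s] by (simp add: dist_of_fun_def)
next
  fix c and \<phi> :: "'a \<Rightarrow> complex" assume s: "schwartz \<phi>"
  have "(LINT x|lborel. f x * (c * \<phi> x)) = (LINT x|lborel. c * (f x * \<phi> x))"
    by (simp add: mult_ac)
  then show "dist_of_fun f (\<lambda>x. c * \<phi> x) = c * dist_of_fun f \<phi>"
    using s schwartz_cmult[OF s] by (simp add: dist_of_fun_def)
next
  show "\<exists>N C. \<forall>\<phi>. schwartz \<phi> \<longrightarrow> norm (dist_of_fun f \<phi>) \<le> C * schwartz_seminorm N \<phi>"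
    using moderate_growth_integrable(2)[OF f int] by (auto simp: dist_of_fun_def)
qed (simp add: dist_of_fun_def)

text \<open>
  The Fourier transform is onto the Schwartz space, so a tempered distribution is determined by its
  transform.
\<close>

lemma tempered_eqI_fourier:
  assumes C: "tempered C" and D: "tempered D" and eq: "\<And>\<phi>. schwartz \<phi> \<Longrightarrow> dist_fourier C \<phi> = dist_fourier D \<phi>"
  shows "C = D"
proof
  fix \<psi> :: "'a \<Rightarrow> complex"
  show "C \<psi> = D \<psi>"
  proof (cases "schwartz \<psi>")
    case True
    then obtain \<phi> where "schwartz \<phi>" "fourier \<phi> = \<psi>" by (rule fourier_surj_schwartz)
    then show ?thesis using eq[of \<phi>] by (simp add: dist_fourier_def)
  next
    case False
    then show ?thesis using C D by (simp add: tempered_def)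
  qed
qed

text \<open>
  The limit determines the Fourier transform and the Fourier transform determines the distribution, so any
  candidate with the right limit is the cone spline.
\<close>

lemma cone_spline_eqI:
  assumes C: "tempered C"
    and lim: "dist_tendsto (\<lambda>\<epsilon>. dist_of_fun (cone_symbol \<alpha> X \<epsilon>)) (dist_fourier C) (at_right 0)"
  shows "cone_spline \<alpha> X = C"
  unfolding cone_spline_def
proof (rule the_equality)
  fix D assume D: "tempered D \<and> dist_tendsto (\<lambda>\<epsilon>. dist_of_fun (cone_symbol \<alpha> X \<epsilon>)) (dist_fourier D) (at_right 0)"
  show "D = C"
  proof (rule tempered_eqI_fourier)
    fix \<phi> :: "real ^ 'a \<Rightarrow> complex" assume "schwartz \<phi>"
    then have "((\<lambda>\<epsilon>. dist_of_fun (cone_symbol \<alpha> X \<epsilon>) \<phi>) \<longlongrightarrow> dist_fourier D \<phi>) (at_right 0)"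
      "((\<lambda>\<epsilon>. dist_of_fun (cone_symbol \<alpha> X \<epsilon>) \<phi>) \<longlongrightarrow> dist_fourier C \<phi>) (at_right 0)"
      using D lim unfolding dist_tendsto_def by auto
    then show "dist_fourier D \<phi> = dist_fourier C \<phi>"
      by (rule tendsto_unique[OF trivial_limit_at_right_real])
  qed (use C D in auto)
qed (use assms in auto)

section \<open>The density of the cone spline\<close>

text \<open>
  Near 0 the damping factor \<open>exp (- t)\<close> is bounded below, so the integrable density with \<open>\<epsilon> = 1\<close> is a
  majorant up to a constant; beyond 1 the quotient is at most a multiple of \<open>1 / (1 + t\<^sup>2)\<close>.
\<close>

lemma gamma_density_decay_integrable:
  assumes a: "a > 0" and m: "real m \<ge> a + 2"
  shows "integrable lborel (\<lambda>t. gamma_density a 0 t / (1 + \<bar>t\<bar>) ^ m)"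
proof (rule Bochner_Integration.integrable_bound)
  have Ga: "Gamma a > 0" using a by (rule Gamma_real_pos)
  show "integrable lborel (\<lambda>t. exp 1 * gamma_density a 1 t + (1 / Gamma a) * (1 / (1 + t\<^sup>2)))"
    using gamma_density_integrable[OF a, of 1]
    by (intro Bochner_Integration.integrable_add integrable_mult_right integrable_inverse_1_plus_square_lborel) auto
  have "gamma_density a 0 t / (1 + \<bar>t\<bar>) ^ m \<le> exp 1 * gamma_density a 1 t + (1 / Gamma a) * (1 / (1 + t\<^sup>2))" for t
  proof -
    consider "t \<le> 0" | "0 < t" "t \<le> 1" | "1 < t" by linarith
    then show ?thesis
    proof cases
      case 1
      then show ?thesis using Ga by (simp add: gamma_density_def)
    next
      case 2
      have "gamma_density a 0 t / (1 + \<bar>t\<bar>) ^ m \<le> gamma_density a 0 t / 1"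
        using gamma_density_nonneg[OF a, of 0 t] by (intro divide_left_mono) (auto simp: one_le_power)
      also have "\<dots> \<le> exp (1 - t) * gamma_density a 0 t"
        using mult_right_mono[of 1 "exp (1 - t)" "gamma_density a 0 t"] 2 gamma_density_nonneg[OF a, of 0 t] by simp
      also have "exp (1 - t) * gamma_density a 0 t = exp 1 * gamma_density a 1 t"
        using 2 by (simp add: gamma_density_def exp_diff exp_minus field_simps)
      also have "\<dots> \<le> exp 1 * gamma_density a 1 t + (1 / Gamma a) * (1 / (1 + t\<^sup>2))"
        using Ga by simp
      finally show ?thesis .
    next
      case 3
      have "t powr (a - 1) \<le> t powr a" using 3 by (intro powr_mono) auto
      also have "\<dots> \<le> (1 + t) powr a" using 3 a by (intro powr_mono2) auto
      finally have "t powr (a - 1) / (1 + t) ^ m \<le> (1 + t) powr a / (1 + t) ^ m"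
        using 3 by (intro divide_right_mono) auto
      also have "\<dots> = (1 + t) powr (a - real m)"
        using 3 by (simp add: powr_diff powr_realpow)
      also have "\<dots> \<le> (1 + t) powr (- 2)" using 3 m by (intro powr_mono) auto
      also have "\<dots> = 1 / (1 + t)\<^sup>2" using 3 by (simp add: powr_minus powr_numeral divide_inverse)
      also have "\<dots> \<le> 1 / (1 + t\<^sup>2)"
        using 3 by (intro divide_left_mono) (auto simp: power2_eq_square algebra_simps add_pos_pos)
      finally have "t powr (a - 1) / (1 + t) ^ m / Gamma a \<le> 1 / (1 + t\<^sup>2) / Gamma a"
        using Ga by (intro divide_right_mono) auto
      then have "gamma_density a 0 t / (1 + \<bar>t\<bar>) ^ m \<le> (1 / Gamma a) * (1 / (1 + t\<^sup>2))"
        using 3 by (simp add: gamma_density_def mult_ac)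
      then show ?thesis using gamma_density_nonneg[OF a, of 1 t] by (simp add: add_increasing)
    qed
  qed
  then show "AE t in lborel. norm (gamma_density a 0 t / (1 + \<bar>t\<bar>) ^ m) \<le> norm (exp 1 * gamma_density a 1 t + (1 / Gamma a) * (1 / (1 + t\<^sup>2)))"
    using gamma_density_nonneg[OF a] Ga by (intro AE_I2) (simp add: abs_mult order_trans[OF _ abs_ge_self])
qed measurable

text \<open>
  With \<open>\<epsilon> = 0\<close> and multiplied by the inverse modulus of the determinant with columns \<open>X k\<close>, this is the classical formula for the
  cone spline as a product of truncated powers in the dual coordinates.
\<close>

definition cone_density :: "real ^ 'n \<Rightarrow> ('n::finite \<Rightarrow> real ^ 'n) \<Rightarrow> real \<Rightarrow> real ^ 'n \<Rightarrow> real" where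
  "cone_density \<alpha> Xd \<epsilon> x = (\<Prod>k\<in>UNIV. gamma_density (\<alpha> $ k) \<epsilon> (x \<bullet> Xd k))"

lemma cone_density_measurable [measurable]: "cone_density \<alpha> Xd \<epsilon> \<in> borel_measurable borel"
  unfolding cone_density_def[abs_def] by measurable

lemma cone_density_nonneg: "(\<And>k. \<alpha> $ k > 0) \<Longrightarrow> cone_density \<alpha> Xd \<epsilon> x \<ge> 0"
  unfolding cone_density_def by (intro prod_nonneg gamma_density_nonneg ballI) auto

lemma cone_density_le:
  assumes "\<And>k. \<alpha> $ k > 0" "\<epsilon> \<ge> 0"
  shows "cone_density \<alpha> Xd \<epsilon> x \<le> cone_density \<alpha> Xd 0 x"
  unfolding cone_density_def
proof (intro prod_mono conjI gamma_density_nonneg assms)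
  fix k
  show "gamma_density (\<alpha> $ k) \<epsilon> (x \<bullet> Xd k) \<le> gamma_density (\<alpha> $ k) 0 (x \<bullet> Xd k)"
    using Gamma_real_pos[OF assms(1)[of k]] assms(2)
    by (auto simp: gamma_density_def intro!: divide_right_mono mult_left_le)
qed

text \<open>
  Each \<open>1 + \<bar>x \<bullet> Xd k\<bar>\<close> is at most a constant times \<open>1 + norm x\<close>, so a power of \<open>1 + norm x\<close> in the
  denominator beats the product of the one-variable denominators, for which the integral factors.
\<close>

lemma cone_density_moderate_growth:
  fixes X Xd :: "'n::finite \<Rightarrow> real ^ 'n"
  assumes dual: "\<And>j k. X j \<bullet> Xd k = (if j = k then 1 else 0)" and pos: "\<And>k. \<alpha> $ k > 0"
  shows "\<exists>N. integrable lborel (\<lambda>x. cone_density \<alpha> Xd 0 x / (1 + norm x) ^ N)"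
proof -
  \<comment> \<open>A single exponent that suffices for all the factors.\<close>
  define m where "m = nat \<lceil>\<Sum>k\<in>UNIV. \<alpha> $ k\<rceil> + 2"
  have m: "real m \<ge> \<alpha> $ k + 2" for k
  proof -
    have "\<alpha> $ k \<le> (\<Sum>k\<in>UNIV. \<alpha> $ k)" using pos by (intro member_le_sum) (auto simp: less_imp_le)
    then show ?thesis unfolding m_def by linarith
  qed
  define B where "B = 1 + (\<Sum>k\<in>UNIV. norm (Xd k))"
  have B: "1 + \<bar>x \<bullet> Xd k\<bar> \<le> B * (1 + norm x)" for x k
  proof -
    have "norm (Xd k) \<le> (\<Sum>k\<in>UNIV. norm (Xd k))" by (intro member_le_sum) auto
    then have "\<bar>x \<bullet> Xd k\<bar> \<le> norm x * (\<Sum>k\<in>UNIV. norm (Xd k))"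
      by (intro order_trans[OF Cauchy_Schwarz_ineq2] mult_left_mono) auto
    then show ?thesis by (simp add: B_def algebra_simps sum_nonneg add_increasing)
  qed
  have B1: "B > 0" unfolding B_def by (intro add_pos_nonneg sum_nonneg) auto
  define N where "N = m * CARD('n)"
  define P where "P = (\<lambda>x. \<Prod>k\<in>UNIV. gamma_density (\<alpha> $ k) 0 (x \<bullet> Xd k) / (1 + \<bar>x \<bullet> Xd k\<bar>) ^ m)"
  have "integrable lborel P"
  proof -
    obtain \<kappa> :: real where \<kappa>: "\<kappa> > 0"
    and product: "\<forall>f :: 'n \<Rightarrow> real \<Rightarrow> complex. (\<forall>k. integrable lborel (f k)) \<longrightarrow>
      integrable lborel (\<lambda>x. \<Prod>k\<in>UNIV. f k (x \<bullet> Xd k)) \<and>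
      (\<forall>\<omega>. fourier (\<lambda>x. complex_of_real \<kappa> * (\<Prod>k\<in>UNIV. f k (x \<bullet> Xd k))) \<omega> = (\<Prod>k\<in>UNIV. fourier (f k) (\<omega> \<bullet> X k)))"
    using fourier_dual_basis_product[OF dual] by auto
    from product[rule_format, THEN conjunct1, of "\<lambda>k t. complex_of_real (gamma_density (\<alpha> $ k) 0 t / (1 + \<bar>t\<bar>) ^ m)"]
    have "integrable lborel (\<lambda>x. complex_of_real (P x))"
      using gamma_density_decay_integrable[OF pos m]
      unfolding P_def of_real_prod by (simp only: integrable_of_real)
    from integrable_Re[OF this] show ?thesis by simp
  qed
  have "integrable lborel (\<lambda>x. cone_density \<alpha> Xd 0 x / (1 + norm x) ^ N)"
  proof (rule Bochner_Integration.integrable_bound)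
    show "integrable lborel (\<lambda>x. B ^ N * P x)" using \<open>integrable lborel P\<close> by simp
    show "AE x in lborel. norm (cone_density \<alpha> Xd 0 x / (1 + norm x) ^ N) \<le> norm (B ^ N * P x)"
    proof (rule AE_I2)
      fix x :: "real ^ 'n"
      have "(\<Prod>k\<in>UNIV. (1 + \<bar>x \<bullet> Xd k\<bar>) ^ m) \<le> (\<Prod>k\<in>(UNIV :: 'n set). (B * (1 + norm x)) ^ m)"
        using B by (intro prod_mono conjI power_mono) auto
      also have "\<dots> = B ^ N * (1 + norm x) ^ N"
        by (simp add: N_def power_mult power_mult_distrib)
      finally have le: "(\<Prod>k\<in>UNIV. (1 + \<bar>x \<bullet> Xd k\<bar>) ^ m) \<le> B ^ N * (1 + norm x) ^ N" .
      have pos1: "(\<Prod>k\<in>UNIV. (1 + \<bar>x \<bullet> Xd k\<bar>) ^ m) > 0"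
        by (intro prod_pos ballI zero_less_power add_pos_nonneg) auto
      have pos2: "(1 + norm x) ^ N > 0" by (intro zero_less_power add_pos_nonneg) auto
      have "cone_density \<alpha> Xd 0 x / (1 + norm x) ^ N = B ^ N * (cone_density \<alpha> Xd 0 x / (B ^ N * (1 + norm x) ^ N))"
        using B1 by simp
      also have "\<dots> \<le> B ^ N * (cone_density \<alpha> Xd 0 x / (\<Prod>k\<in>UNIV. (1 + \<bar>x \<bullet> Xd k\<bar>) ^ m))"
        using B1 pos1 pos2 le cone_density_nonneg[of \<alpha> Xd 0 x] pos
        by (intro mult_left_mono divide_left_mono mult_pos_pos) auto
      also have "\<dots> = B ^ N * P x"
        by (simp add: P_def cone_density_def prod_dividef)
      finally show "norm (cone_density \<alpha> Xd 0 x / (1 + norm x) ^ N) \<le> norm (B ^ N * P x)"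
        using cone_density_nonneg[of \<alpha> Xd 0 x] pos pos2 by (simp add: order_trans[OF _ abs_ge_self])
    qed
  qed measurable
  then show ?thesis by blast
qed

text \<open>
  For \<open>\<epsilon> > 0\<close> the damped density is integrable with Fourier transform the symbol
  \<open>\<Prod>k. (\<epsilon> + \<i> (\<omega> \<bullet> X k)) powr (- \<alpha> k)\<close>. By the multiplication formula, pairing the symbol with \<open>\<phi>\<close>
  is pairing the damped density with the transform of \<open>\<phi>\<close>. As \<open>\<epsilon>\<close> tends to 0, this
  converges by dominated convergence to the pairing with the undamped density. The constant
  \<open>\<kappa>\<close> is chosen before \<open>\<alpha>\<close> because the recurrence compares splines with different exponents.
\<close>

theorem cone_spline_eq_cone_density:
  fixes X Xd :: "'n::finite \<Rightarrow> real ^ 'n"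
  assumes dual: "\<And>j k. X j \<bullet> Xd k = (if j = k then 1 else 0)"
  shows "\<exists>\<kappa>. \<forall>\<alpha>. (\<forall>k. \<alpha> $ k > 0) \<longrightarrow>
    cone_spline \<alpha> X = dist_of_fun (\<lambda>x. complex_of_real (\<kappa> * cone_density \<alpha> Xd 0 x))"
proof -
  obtain \<kappa> :: real where \<kappa>: "\<kappa> > 0"
    and product: "\<forall>f :: 'n \<Rightarrow> real \<Rightarrow> complex. (\<forall>k. integrable lborel (f k)) \<longrightarrow>
      integrable lborel (\<lambda>x. \<Prod>k\<in>UNIV. f k (x \<bullet> Xd k)) \<and>
      (\<forall>\<omega>. fourier (\<lambda>x. complex_of_real \<kappa> * (\<Prod>k\<in>UNIV. f k (x \<bullet> Xd k))) \<omega> = (\<Prod>k\<in>UNIV. fourier (f k) (\<omega> \<bullet> X k)))"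
    using fourier_dual_basis_product[OF dual] by auto
  have "cone_spline \<alpha> X = dist_of_fun (\<lambda>x. complex_of_real (\<kappa> * cone_density \<alpha> Xd 0 x))"
    if pos: "\<And>k. \<alpha> $ k > 0" for \<alpha>
  proof (rule cone_spline_eqI)
    define C where "C = (\<lambda>\<epsilon> x. complex_of_real (\<kappa> * cone_density \<alpha> Xd \<epsilon> x))"
    have Cm[measurable]: "C \<epsilon> \<in> borel_measurable borel" for \<epsilon> unfolding C_def by measurable
    have norm_C: "norm (C \<epsilon> x) = \<kappa> * cone_density \<alpha> Xd \<epsilon> x" for \<epsilon> x
      using \<kappa> cone_density_nonneg[of \<alpha> Xd \<epsilon> x] pos by (simp add: C_def norm_mult)
    obtain N where N0: "integrable lborel (\<lambda>x. cone_density \<alpha> Xd 0 x / (1 + norm x) ^ N)"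
      using cone_density_moderate_growth[OF dual pos] by blast
    have N: "integrable lborel (\<lambda>x. norm (C 0 x) / (1 + norm x) ^ N)"
      using integrable_mult_right[OF N0, of \<kappa>] by (simp add: norm_C)
    show "tempered (dist_of_fun (\<lambda>x. complex_of_real (\<kappa> * cone_density \<alpha> Xd 0 x)))"
      using tempered_dist_of_fun[OF Cm N] by (simp add: C_def)
    have C_int: "integrable lborel (C \<epsilon>)" and C_fourier: "fourier (C \<epsilon>) = cone_symbol \<alpha> X \<epsilon>" if e: "\<epsilon> > 0" for \<epsilon>
    proof -
      have g: "integrable lborel (\<lambda>t. complex_of_real (gamma_density (\<alpha> $ k) \<epsilon> t))" for k
        using pos e by (intro integrable_of_real gamma_density_integrable) auto
      have C_eq: "C \<epsilon> = (\<lambda>x. complex_of_real \<kappa> * (\<Prod>k\<in>UNIV. complex_of_real (gamma_density (\<alpha> $ k) \<epsilon> (x \<bullet> Xd k))))"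
        by (simp add: C_def cone_density_def fun_eq_iff)
      show "integrable lborel (C \<epsilon>)"
        unfolding C_eq by (intro integrable_mult_right product[rule_format, THEN conjunct1] g)
      show "fourier (C \<epsilon>) = cone_symbol \<alpha> X \<epsilon>"
      proof
        fix \<omega>
        show "fourier (C \<epsilon>) \<omega> = cone_symbol \<alpha> X \<epsilon> \<omega>"
          unfolding C_eq product[rule_format, THEN conjunct2, rule_format, OF g] cone_symbol_def
          by (intro prod.cong refl gamma_transform_eq pos e)
      qed
    qed
    show "dist_tendsto (\<lambda>\<epsilon>. dist_of_fun (cone_symbol \<alpha> X \<epsilon>)) (dist_fourier (dist_of_fun (\<lambda>x. complex_of_real (\<kappa> * cone_density \<alpha> Xd 0 x)))) (at_right 0)"
      unfolding dist_tendsto_def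
    proof (intro allI impI)
      fix \<phi> :: "real ^ 'n \<Rightarrow> complex" assume \<phi>: "schwartz \<phi>"
      have F: "schwartz (fourier \<phi>)" using \<phi> by (rule schwartz_fourier)
      have Fm[measurable]: "fourier \<phi> \<in> borel_measurable borel" using F by (rule schwartz_measurable)
      have "((\<lambda>\<epsilon>. LINT x|lborel. C \<epsilon> x * fourier \<phi> x) \<longlongrightarrow> (LINT x|lborel. C 0 x * fourier \<phi> x)) (at_right 0)"
        unfolding filterlim_at_right_to_top
      proof (rule integral_dominated_convergence_at_top[where w="\<lambda>x. norm (C 0 x * fourier \<phi> x)"])
        show "integrable lborel (\<lambda>x. norm (C 0 x * fourier \<phi> x))"
          by (intro integrable_norm moderate_growth_integrable(1)[OF Cm N F])
        show "\<forall>\<^sub>F r in at_top. AE x in lborel. norm (C (inverse r) x * fourier \<phi> x) \<le> norm (C 0 x * fourier \<phi> x)"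
          using eventually_gt_at_top[of 0]
        proof eventually_elim
          case (elim r)
          then show ?case
            unfolding norm_mult norm_C using \<kappa> pos
            by (intro AE_I2 mult_right_mono mult_left_mono cone_density_le) auto
        qed
        show "AE x in lborel. ((\<lambda>r. C (inverse r) x * fourier \<phi> x) \<longlongrightarrow> C 0 x * fourier \<phi> x) at_top"
        proof (rule AE_I2)
          fix x
          have "((\<lambda>r. gamma_density a (inverse r) t) \<longlongrightarrow> gamma_density a 0 t) at_top" for a t :: real
          proof (cases "t > 0")
            case True
            have "((\<lambda>r. t powr (a - 1) * exp (- (inverse r * t)) / Gamma a) \<longlongrightarrow> t powr (a - 1) * exp (- (0 * t)) / Gamma a) at_top"
              unfolding divide_inverse by (intro tendsto_intros tendsto_inverse_0_at_top filterlim_ident)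
            then show ?thesis using True by (simp add: gamma_density_def)
          qed (simp add: gamma_density_def)
          then show "((\<lambda>r. C (inverse r) x * fourier \<phi> x) \<longlongrightarrow> C 0 x * fourier \<phi> x) at_top"
            unfolding C_def cone_density_def by (intro tendsto_intros)
        qed
      qed measurable
      moreover have "\<forall>\<^sub>F \<epsilon> in at_right 0. (LINT x|lborel. C \<epsilon> x * fourier \<phi> x) = dist_of_fun (cone_symbol \<alpha> X \<epsilon>) \<phi>"
        using eventually_at_right_less[of 0]
      proof eventually_elim
        case (elim \<epsilon>)
        then show ?case
          using fourier_multiplication_formula[OF C_int[OF elim] schwartz_integrable[OF \<phi>]] C_fourier[OF elim] \<phi>
          by (simp add: dist_of_fun_def)
      qed
      ultimately have "((\<lambda>\<epsilon>. dist_of_fun (cone_symbol \<alpha> X \<epsilon>) \<phi>) \<longlongrightarrow> (LINT x|lborel. C 0 x * fourier \<phi> x)) (at_right 0)"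
        by (rule Lim_transform_eventually)
      then show "((\<lambda>\<epsilon>. dist_of_fun (cone_symbol \<alpha> X \<epsilon>) \<phi>) \<longlongrightarrow> dist_fourier (dist_of_fun (\<lambda>x. complex_of_real (\<kappa> * cone_density \<alpha> Xd 0 x))) \<phi>) (at_right 0)"
        using \<phi> F by (simp add: dist_fourier_def dist_of_fun_def C_def)
    qed
  qed
  then show ?thesis by blast
qed

section \<open>The recurrence\<close>

text \<open>
  Only the factor with index \<open>k\<close> changes. Up to the common damping factor its change is \<open>t * t powr (a - 2) / \<Gamma>(a - 1) =
  (a - 1) * t powr (a - 1) / \<Gamma>(a)\<close>.
\<close>

lemma cone_density_step:
  fixes Xd :: "'n::finite \<Rightarrow> real ^ 'n"
  assumes "\<alpha> $ k > 1"
  shows "(x \<bullet> Xd k) * cone_density (\<alpha> - axis k 1) Xd \<epsilon> x = (\<alpha> $ k - 1) * cone_density \<alpha> Xd \<epsilon> x"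
proof -
  let ?R = "\<Prod>j\<in>UNIV - {k}. gamma_density (\<alpha> $ j) \<epsilon> (x \<bullet> Xd j)"
  have 1: "cone_density \<alpha> Xd \<epsilon> x = gamma_density (\<alpha> $ k) \<epsilon> (x \<bullet> Xd k) * ?R"
    unfolding cone_density_def by (rule prod.remove) auto
  have "cone_density (\<alpha> - axis k 1) Xd \<epsilon> x = gamma_density ((\<alpha> - axis k 1) $ k) \<epsilon> (x \<bullet> Xd k) *
      (\<Prod>j\<in>UNIV - {k}. gamma_density ((\<alpha> - axis k 1) $ j) \<epsilon> (x \<bullet> Xd j))"
    unfolding cone_density_def by (rule prod.remove) auto
  also have "\<dots> = gamma_density (\<alpha> $ k - 1) \<epsilon> (x \<bullet> Xd k) * ?R"
    by (intro arg_cong2[where f="(*)"] prod.cong) (auto simp: axis_def)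
  finally have 2: "cone_density (\<alpha> - axis k 1) Xd \<epsilon> x = gamma_density (\<alpha> $ k - 1) \<epsilon> (x \<bullet> Xd k) * ?R" .
  show ?thesis
    unfolding 1 2 using gamma_density_step[of "\<alpha> $ k - 1" "x \<bullet> Xd k" \<epsilon>] assms
    by (simp add: mult.assoc[symmetric])
qed

theorem proposition5p2:
  fixes X Xd :: "'n::finite \<Rightarrow> real ^ 'n" and \<alpha> :: "real ^ 'n"
  assumes "inj X" and "independent (range X)"
    and "\<forall>j k. X j \<bullet> Xd k = (if j = k then 1 else 0)"
    and "\<forall>k. 0 < \<alpha> $ k"
    and "\<forall>k j. 0 < (\<alpha> - axis k 1) $ j"
    and "(\<Sum>k\<in>UNIV. \<alpha> $ k) \<noteq> real CARD('n)"
  shows "cone_spline \<alpha> X =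
    (\<lambda>\<phi>. complex_of_real (1 / ((\<Sum>k\<in>UNIV. \<alpha> $ k) - real CARD('n))) *
         (\<Sum>k\<in>UNIV. dist_mult (\<lambda>x. x \<bullet> Xd k) (cone_spline (\<alpha> - axis k 1) X) \<phi>))"
proof -
  obtain \<kappa> where \<kappa>: "\<And>\<alpha>. (\<forall>k. \<alpha> $ k > 0) \<Longrightarrow>
      cone_spline \<alpha> X = dist_of_fun (\<lambda>x. complex_of_real (\<kappa> * cone_density \<alpha> Xd 0 x))"
    using cone_spline_eq_cone_density[of X Xd] assms(3) by blast
  have gt1: "\<alpha> $ k > 1" for k
    using assms(5)[rule_format, of k k] by (simp add: axis_def)
  have summand: "dist_mult (\<lambda>x. x \<bullet> Xd k) (cone_spline (\<alpha> - axis k 1) X) \<phi> = complex_of_real (\<alpha> $ k - 1) * cone_spline \<alpha> X \<phi>" for k \<phi>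
  proof (cases "schwartz \<phi>")
    case True
    have "dist_mult (\<lambda>x. x \<bullet> Xd k) (cone_spline (\<alpha> - axis k 1) X) \<phi> =
        (LINT x|lborel. complex_of_real (\<kappa> * cone_density (\<alpha> - axis k 1) Xd 0 x) * (complex_of_real (x \<bullet> Xd k) * \<phi> x))"
      using \<kappa>[of "\<alpha> - axis k 1"] assms(5) True schwartz_mult_coordinate[OF True, of "Xd k"]
      by (simp add: dist_mult_def dist_of_fun_def)
    also have "\<dots> = (LINT x|lborel. complex_of_real (\<alpha> $ k - 1) * (complex_of_real (\<kappa> * cone_density \<alpha> Xd 0 x) * \<phi> x))"
    proof (intro Bochner_Integration.integral_cong refl)
      fix x
      have "(\<kappa> * cone_density (\<alpha> - axis k 1) Xd 0 x) * (x \<bullet> Xd k) = (\<alpha> $ k - 1) * (\<kappa> * cone_density \<alpha> Xd 0 x)"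
        using cone_density_step[OF gt1, of x Xd k 0] by (simp add: mult_ac)
      then have "complex_of_real (\<kappa> * cone_density (\<alpha> - axis k 1) Xd 0 x) * complex_of_real (x \<bullet> Xd k) =
          complex_of_real (\<alpha> $ k - 1) * complex_of_real (\<kappa> * cone_density \<alpha> Xd 0 x)"
        by (simp only: of_real_mult[symmetric])
      then show "complex_of_real (\<kappa> * cone_density (\<alpha> - axis k 1) Xd 0 x) * (complex_of_real (x \<bullet> Xd k) * \<phi> x) =
          complex_of_real (\<alpha> $ k - 1) * (complex_of_real (\<kappa> * cone_density \<alpha> Xd 0 x) * \<phi> x)"
        by (simp only: mult.assoc[symmetric])
    qed
    also have "\<dots> = complex_of_real (\<alpha> $ k - 1) * cone_spline \<alpha> X \<phi>"
      using \<kappa>[of \<alpha>] assms(4) True by (simp add: dist_of_fun_def)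
    finally show ?thesis .
  next
    case False
    then show ?thesis using \<kappa>[of \<alpha>] assms(4) by (simp add: dist_mult_def dist_of_fun_def)
  qed
  define d where "d = (\<Sum>k\<in>UNIV. \<alpha> $ k) - real CARD('n)"
  have "d \<noteq> 0" using assms(6) by (simp add: d_def)
  have "(\<Sum>k\<in>UNIV. complex_of_real (\<alpha> $ k - 1)) = complex_of_real d"
    by (simp add: d_def sum_subtractf)
  then have "(\<Sum>k\<in>UNIV. dist_mult (\<lambda>x. x \<bullet> Xd k) (cone_spline (\<alpha> - axis k 1) X) \<phi>) =
      complex_of_real d * cone_spline \<alpha> X \<phi>" for \<phi>
    unfolding summand by (simp only: sum_distrib_right[symmetric])
  then show ?thesis
    unfolding d_def[symmetric] using \<open>d \<noteq> 0\<close> by (simp add: fun_eq_iff)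
qed

end
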